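(* Let $\Gamma_A,\Gamma_A',\Gamma_B,\Gamma_B'$ be $n$-coloured flag simplicial complexes. A pair of colour-preserving simplicial maps $f_A\colon\Gamma_A\to\Gamma_A'$ and $f_B\colon\Gamma_B\to\Gamma_B'$ induces a cubical map $X(f_A,f_B)\colon X_{\Gamma_A,\Gamma_B}\to X_{\Gamma_A',\Gamma_B'}$ (given on vertices by $(\mathfrak a,\mathfrak b)\mapsto(f_A(\mathfrak a),f_B(\mathfrak b))$). Furthermore, if $f_A$ and $f_B$ are inclusions of full subcomplexes, then $X(f_A,f_B)$ is a local isometry and hence induces an injection of fundamental groups (for every choice of base point $x_0\in X_{\Gamma_A,\Gamma_B}$).
   Context: All simplicial complexes are finite, and the empty set counts as a simplex of every complex. An $n$-coloured simplicial complex is a simplicial complex whose vertex set is partitioned into $n$ labelled (possibly empty) classes, the colours $1,\dots,n$, so that adjacent vertices have different colours. Let $\Gamma_A,\Gamma_B$ be $n$-coloured with colour classes $A_1,\dots,A_n$ and $B_1,\dots,B_n$. Let $K=\prod_{i=1}^n (A_i*B_i)$, a product of complete bipartite graphs, viewed as a cube complex. A vertex $(x_1,\dots,x_n)$ of $K$, $x_i\in A_i\sqcup B_i$, is identified with the pair $(\mathfrak a,\mathfrak b)$, $\mathfrak a=\{x_i: x_i\in A_i\}$, $\mathfrak b=\{x_i: x_i\in B_i\}$. The coupled link cube complex $X_{\Gamma_A,\Gamma_B}$ is the full subcomplex of $K$ (all cubes all of whose vertices belong to it) on the vertices $(\mathfrak a,\mathfrak b)$ such that $\mathfrak a$ is a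 (possibly empty) simplex of $\Gamma_A$ and $\mathfrak b$ is a (possibly empty) simplex of $\Gamma_B$. A simplicial complex is flag if every set of pairwise adjacent vertices spans a simplex. A subcomplex is full if it contains every simplex all of whose vertices lie in it. A map of cube complexes is cubical if it maps every $n$-cube onto a $k$-cube for some $k\le n$ via a projection $[0,1]^n\to[0,1]^k$. Each connected component of a cube complex carries the path metric obtained by giving each cube the Euclidean metric of $[0,1]^k$. A local isometry is a map such that every point of the source has a neighbourhood on which the map is an isometric embedding. *)

theory Defs
  imports "HOL-Analysis.Analysis" "HOL-Algebra.Group"
begin

section \<open>Coloured simplicial complexes\<close>

text \<open>The colour classes are the sets \<open>{v \<in> vertices (simplices \<Gamma>). colour \<Gamma> v = i}\<close> for \<open>i \<in> {1..n}\<close>;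
  they may be empty. Values of \<open>colour \<Gamma>\<close> outside the vertex set are irrelevant.\<close>

record 'a coloured_complex =
  simplices :: "'a set set"
  colour :: "'a \<Rightarrow> nat"

definition simplicial_complex :: "'a set set \<Rightarrow> bool" where
  "simplicial_complex K \<longleftrightarrow> finite K \<and> {} \<in> K \<and> (\<forall>\<sigma>\<in>K. finite \<sigma> \<and> (\<forall>\<tau>. \<tau> \<subseteq> \<sigma> \<longrightarrow> \<tau> \<in> K))"

definition vertices :: "'a set set \<Rightarrow> 'a set" where
  "vertices K = {v. {v} \<in> K}"

definition is_coloured :: "nat \<Rightarrow> 'a coloured_complex \<Rightarrow> bool" where
  "is_coloured n \<Gamma> \<longleftrightarrow> simplicial_complex (simplices \<Gamma>)
     \<and> (\<forall>v\<in>vertices (simplices \<Gamma>). colour \<Gamma> v \<in> {1..n})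
     \<and> (\<forall>u v. u \<noteq> v \<and> {u, v} \<in> simplices \<Gamma> \<longrightarrow> colour \<Gamma> u \<noteq> colour \<Gamma> v)"

definition colour_class :: "'a coloured_complex \<Rightarrow> nat \<Rightarrow> 'a set" where
  "colour_class \<Gamma> i = {v \<in> vertices (simplices \<Gamma>). colour \<Gamma> v = i}"

definition flag_complex :: "'a set set \<Rightarrow> bool" where
  "flag_complex K \<longleftrightarrow>
     (\<forall>\<sigma>. \<sigma> \<subseteq> vertices K \<and> (\<forall>u\<in>\<sigma>. \<forall>v\<in>\<sigma>. u \<noteq> v \<longrightarrow> {u, v} \<in> K) \<longrightarrow> \<sigma> \<in> K)"

definition full_subcomplex :: "'a set set \<Rightarrow> 'a set set \<Rightarrow> bool" where
  "full_subcomplex L K \<longleftrightarrow> simplicial_complex L \<and> L \<subseteq> K \<and> (\<forall>\<sigma>\<in>K. \<sigma> \<subseteq> vertices L \<longrightarrow> \<sigma> \<in> L)"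

definition simplicial_map :: "'a set set \<Rightarrow> 'b set set \<Rightarrow> ('a \<Rightarrow> 'b) \<Rightarrow> bool" where
  "simplicial_map K L f \<longleftrightarrow> (\<forall>\<sigma>\<in>K. f ` \<sigma> \<in> L)"

definition coloured_map :: "'a coloured_complex \<Rightarrow> 'b coloured_complex \<Rightarrow> ('a \<Rightarrow> 'b) \<Rightarrow> bool" where
  "coloured_map \<Gamma> \<Gamma>' f \<longleftrightarrow> simplicial_map (simplices \<Gamma>) (simplices \<Gamma>') f
     \<and> (\<forall>v\<in>vertices (simplices \<Gamma>). colour \<Gamma>' (f v) = colour \<Gamma> v)"

text \<open>Source and target may have different vertex types, so an inclusion is an injective map that
  identifies the source with a full subcomplex of the target. (A simplicial map that is injective
  on vertices is an isomorphism onto its image complex.) For literal inclusions, \<open>f\<close> is the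
  identity.\<close>

definition full_inclusion :: "'a set set \<Rightarrow> 'b set set \<Rightarrow> ('a \<Rightarrow> 'b) \<Rightarrow> bool" where
  "full_inclusion K L f \<longleftrightarrow> inj_on f (vertices K) \<and> full_subcomplex ((`) f ` K) L"


section \<open>Cube complexes in products of complete bipartite graphs\<close>

text \<open>A cube of a product of \<open>n\<close> graphs is given by its factors: a function \<open>E\<close> such that every
  \<open>E i\<close>, \<open>i \<in> {1..n}\<close>, is (the vertex set of) a vertex or an edge of the \<open>i\<close>-th graph. The vertices
  of the cube are the elements of \<open>PiE {1..n} E\<close>, and its dimension is the number of factors that
  are edges. A cube complex is represented by its set of cubes. The two sides of a complete
  bipartite graph \<open>A * B\<close> are tagged by \<open>Inl\<close> and \<open>Inr\<close>, so \<open>A\<close> and \<open>B\<close> need not be disjoint.\<close>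

definition join_cells :: "'a set \<Rightarrow> 'b set \<Rightarrow> ('a + 'b) set set" where
  "join_cells A B = {{Inl a} | a. a \<in> A} \<union> {{Inr b} | b. b \<in> B} \<union> {{Inl a, Inr b} | a b. a \<in> A \<and> b \<in> B}"

definition ambient_vertices ::
  "nat \<Rightarrow> 'a coloured_complex \<Rightarrow> 'b coloured_complex \<Rightarrow> (nat \<Rightarrow> 'a + 'b) set" where
  "ambient_vertices n \<Gamma>A \<Gamma>B = (\<Pi>\<^sub>E i\<in>{1..n}. Inl ` colour_class \<Gamma>A i \<union> Inr ` colour_class \<Gamma>B i)"

definition ambient_cubes ::
  "nat \<Rightarrow> 'a coloured_complex \<Rightarrow> 'b coloured_complex \<Rightarrow> (nat \<Rightarrow> ('a + 'b) set) set" where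
  "ambient_cubes n \<Gamma>A \<Gamma>B = (\<Pi>\<^sub>E i\<in>{1..n}. join_cells (colour_class \<Gamma>A i) (colour_class \<Gamma>B i))"

definition A_part :: "nat \<Rightarrow> (nat \<Rightarrow> 'a + 'b) \<Rightarrow> 'a set" where
  "A_part n x = {a. \<exists>i\<in>{1..n}. x i = Inl a}"

definition B_part :: "nat \<Rightarrow> (nat \<Rightarrow> 'a + 'b) \<Rightarrow> 'b set" where
  "B_part n x = {b. \<exists>i\<in>{1..n}. x i = Inr b}"

definition link_vertices ::
  "nat \<Rightarrow> 'a coloured_complex \<Rightarrow> 'b coloured_complex \<Rightarrow> (nat \<Rightarrow> 'a + 'b) set" where
  "link_vertices n \<Gamma>A \<Gamma>B =
     {x \<in> ambient_vertices n \<Gamma>A \<Gamma>B. A_part n x \<in> simplices \<Gamma>A \<and> B_part n x \<in> simplices \<Gamma>B}"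

definition coupled_link_complex ::
  "nat \<Rightarrow> 'a coloured_complex \<Rightarrow> 'b coloured_complex \<Rightarrow> (nat \<Rightarrow> ('a + 'b) set) set" where
  "coupled_link_complex n \<Gamma>A \<Gamma>B = {E \<in> ambient_cubes n \<Gamma>A \<Gamma>B. PiE {1..n} E \<subseteq> link_vertices n \<Gamma>A \<Gamma>B}"


section \<open>Geometric realization\<close>

text \<open>The realization of a graph consists of barycentric coordinate functions on its vertices, and
  a point of a product of graphs has one such function for each \<open>i \<in> {1..n}\<close>. The topology is the
  subspace topology from the product topology on \<open>nat \<Rightarrow> 'a + 'b \<Rightarrow> real\<close>; for finitely many cubes
  this is the usual one.\<close>

type_synonym ('a, 'b) point = "nat \<Rightarrow> 'a + 'b \<Rightarrow> real"

definition closed_cell :: "'v set \<Rightarrow> ('v \<Rightarrow> real) set" where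
  "closed_cell \<sigma> = {t. (\<forall>v. 0 \<le> t v) \<and> (\<forall>v. v \<notin> \<sigma> \<longrightarrow> t v = 0) \<and> sum t \<sigma> = 1}"

definition closed_cube :: "nat \<Rightarrow> (nat \<Rightarrow> ('a + 'b) set) \<Rightarrow> ('a, 'b) point set" where
  "closed_cube n E = (\<Pi>\<^sub>E i\<in>{1..n}. closed_cell (E i))"

definition realization :: "nat \<Rightarrow> (nat \<Rightarrow> ('a + 'b) set) set \<Rightarrow> ('a, 'b) point set" where
  "realization n C = (\<Union>E\<in>C. closed_cube n E)"

definition vertex_point :: "nat \<Rightarrow> (nat \<Rightarrow> 'a + 'b) \<Rightarrow> ('a, 'b) point" where
  "vertex_point n x = (\<lambda>i\<in>{1..n}. \<lambda>v. if v = x i then 1 else 0)"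

text \<open>\<open>coord p i\<close> is the total weight of \<open>p i\<close> on the \<open>B\<close>-side: it folds the \<open>i\<close>-th complete bipartite
  graph onto \<open>[0,1]\<close>, sending every \<open>A\<close>-vertex to \<open>0\<close>, every \<open>B\<close>-vertex to \<open>1\<close>, and every edge
  affinely onto \<open>[0,1]\<close>. On the cube \<open>E\<close>, the coordinates with index in \<open>directions n E\<close> identify
  \<open>closed_cube n E\<close> with \<open>[0,1]\<^sup>k\<close>, \<open>k = card (directions n E)\<close>; the others are constant.\<close>

definition coord :: "('a, 'b) point \<Rightarrow> nat \<Rightarrow> real" where
  "coord p i = (\<Sum>b | p i (Inr b) \<noteq> 0. p i (Inr b))"

definition directions :: "nat \<Rightarrow> (nat \<Rightarrow> ('a + 'b) set) \<Rightarrow> nat set" where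
  "directions n E = {i \<in> {1..n}. card (E i) = 2}"

text \<open>Cubes are identified with \<open>[0,1]\<^sup>k\<close> only up to the symmetries of \<open>[0,1]\<^sup>k\<close>. Accordingly, a
  projection \<open>[0,1]\<^sup>k \<rightarrow> [0,1]\<^sup>l\<close> is described by the injection \<open>j\<close> that selects a source coordinate
  for every target coordinate, and by the set \<open>R\<close> of target coordinates that are reversed.\<close>

definition cubical_map :: "nat \<Rightarrow> (nat \<Rightarrow> ('a + 'b) set) set \<Rightarrow> (nat \<Rightarrow> ('c + 'd) set) set
    \<Rightarrow> (('a, 'b) point \<Rightarrow> ('c, 'd) point) \<Rightarrow> bool" where
  "cubical_map n C C' F \<longleftrightarrow>
     (\<forall>E\<in>C. \<exists>E'\<in>C'. F ` closed_cube n E = closed_cube n E' \<and>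
        (\<exists>j R. inj_on j (directions n E') \<and> j ` directions n E' \<subseteq> directions n E \<and>
          (\<forall>p\<in>closed_cube n E. \<forall>i\<in>directions n E'.
             coord (F p) i = (if i \<in> R then 1 - coord p (j i) else coord p (j i)))))"


section \<open>Path metric and local isometries\<close>

text \<open>\<open>cube_dist n p q\<close> is the Euclidean distance of two points of a common closed cube.\<close>

definition cube_dist :: "nat \<Rightarrow> ('a, 'b) point \<Rightarrow> ('a, 'b) point \<Rightarrow> real" where
  "cube_dist n p q = L2_set (\<lambda>i. coord p i - coord q i) {1..n}"

text \<open>Strings are the piecewise straight paths, given by their break points; consecutive break points
  lie in a common closed cube. The path metric is the infimum of the lengths of such paths. It is
  \<open>\<infinity>\<close> for points of different connected components and finite within each component.\<close>

definition strings :: "nat \<Rightarrow> (nat \<Rightarrow> ('a + 'b) set) set \<Rightarrow> ('a, 'b) point \<Rightarrow> ('a, 'b) point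
    \<Rightarrow> ('a, 'b) point list set" where
  "strings n C x y = {ps. ps \<noteq> [] \<and> hd ps = x \<and> last ps = y \<and> set ps \<subseteq> realization n C \<and>
     successively (\<lambda>p q. \<exists>E\<in>C. p \<in> closed_cube n E \<and> q \<in> closed_cube n E) ps}"

definition string_length :: "nat \<Rightarrow> ('a, 'b) point list \<Rightarrow> real" where
  "string_length n ps = (\<Sum>k<length ps - 1. cube_dist n (ps ! k) (ps ! Suc k))"

definition path_dist :: "nat \<Rightarrow> (nat \<Rightarrow> ('a + 'b) set) set \<Rightarrow> ('a, 'b) point \<Rightarrow> ('a, 'b) point \<Rightarrow> ereal" where
  "path_dist n C x y = (INF ps\<in>strings n C x y. ereal (string_length n ps))"

definition local_isometry :: "nat \<Rightarrow> (nat \<Rightarrow> ('a + 'b) set) set \<Rightarrow> (nat \<Rightarrow> ('c + 'd) set) set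
    \<Rightarrow> (('a, 'b) point \<Rightarrow> ('c, 'd) point) \<Rightarrow> bool" where
  "local_isometry n C C' F \<longleftrightarrow>
     F ` realization n C \<subseteq> realization n C' \<and>
     (\<forall>x\<in>realization n C. \<exists>U. openin (top_of_set (realization n C)) U \<and> x \<in> U \<and>
        (\<forall>u\<in>U. \<forall>v\<in>U. path_dist n C' (F u) (F v) = path_dist n C u v))"


section \<open>Fundamental groups\<close>

definition loop_class :: "'p::topological_space set \<Rightarrow> (real \<Rightarrow> 'p) \<Rightarrow> (real \<Rightarrow> 'p) set" where
  "loop_class S p = {q. homotopic_paths S p q}"

definition loops_at :: "'p::topological_space set \<Rightarrow> 'p \<Rightarrow> (real \<Rightarrow> 'p) set" where
  "loops_at S x = {p. path p \<and> path_image p \<subseteq> S \<and> pathstart p = x \<and> pathfinish p = x}"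

definition fundamental_group :: "'p::topological_space set \<Rightarrow> 'p \<Rightarrow> (real \<Rightarrow> 'p) set monoid" where
  "fundamental_group S x =
     \<lparr>carrier = loop_class S ` loops_at S x,
      monoid.mult = (\<lambda>P Q. {r. \<exists>p\<in>P. \<exists>q\<in>Q. homotopic_paths S (p +++ q) r}),
      one = loop_class S (\<lambda>_. x)\<rparr>"

text \<open>The map on homotopy classes induced by \<open>F\<close>, where \<open>S'\<close> is the target space.\<close>

definition induced_map :: "'q::topological_space set \<Rightarrow> ('p::topological_space \<Rightarrow> 'q)
    \<Rightarrow> (real \<Rightarrow> 'p) set \<Rightarrow> (real \<Rightarrow> 'q) set" where
  "induced_map S' F P = {r. \<exists>p\<in>P. homotopic_paths S' (F \<circ> p) r}"


section \<open>The map induced by a pair of coloured maps\<close>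

text \<open>On every factor, \<open>coupled_map n f\<^sub>A f\<^sub>B\<close> is the affine extension of the map of complete bipartite
  graphs given by \<open>f\<^sub>A\<close> and \<open>f\<^sub>B\<close> on the two sides.\<close>

definition push_forward :: "('v \<Rightarrow> 'w) \<Rightarrow> ('v \<Rightarrow> real) \<Rightarrow> 'w \<Rightarrow> real" where
  "push_forward f t w = (\<Sum>v | t v \<noteq> 0 \<and> f v = w. t v)"

definition coupled_map :: "nat \<Rightarrow> ('a \<Rightarrow> 'c) \<Rightarrow> ('b \<Rightarrow> 'd) \<Rightarrow> ('a, 'b) point \<Rightarrow> ('c, 'd) point" where
  "coupled_map n fA fB p = (\<lambda>i\<in>{1..n}. push_forward (map_sum fA fB) (p i))"

end

theory Submission
  imports Defs
begin

text \<open>Every map in the proof is, in each factor of the product, the affine extension of a map of vertices.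

  Local isometry: near a point of the source, the affine map that discards the vertices outside the
  source subcomplex is a 1-Lipschitz retraction, and sufficiently short strings stay in the star where it
  is defined. So strings in the target are no shorter than strings in the source.

  Injectivity on fundamental groups: flagness makes the coupled link complex special, so the canonical
  completion of Haglund and Wise applies. It is a covering of the target that contains the source as a
  retract. A homotopy in the target between two paths of the source lifts to the completion, and the
  retraction carries the lift back to the source.\<close>

section \<open>Lifting homotopies in covering spaces\<close>

text \<open>The usual proof of injectivity goes through nonpositive curvature: a local isometry
  preserves local geodesics. Here the two conclusions are proved independently of each other, and
  injectivity becomes a statement about cells and their lifts. The retraction of the local argument
  cannot be used globally, because a cell of the target may have a factor that avoids the source and
  then determines no vertex there. The completion repairs this by carrying such a vertex along as a
  second coordinate, so its fibre over a vertex of the target consists of all vertices of the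
  source. Fullness makes adjacency in the target restrict to adjacency in the source. Flagness turns
  membership of a cell into conditions on pairs of factors, so lifts can be built one factor at a
  time; what remains is to see that changes in different factors do not disturb each other. The
  completion is labelled by edges of the factor graphs rather than by hyperplanes of the target, so
  parallel edges are treated alike from the start.\<close>

lemma covering_space_homeomorphic:
  assumes cov: "covering_space C p S" and e: "homeomorphism C C' e e'" and k: "homeomorphism S S' k k'"
  shows "covering_space C' (k \<circ> p \<circ> e') S'"
proof
  have ee: "\<And>x. x \<in> C \<Longrightarrow> e' (e x) = x" "\<And>y. y \<in> C' \<Longrightarrow> e (e' y) = y"
    "\<And>x. x \<in> C \<Longrightarrow> e x \<in> C'" "\<And>y. y \<in> C' \<Longrightarrow> e' y \<in> C"
    using e by (auto simp: homeomorphism_def)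
  have kk: "\<And>x. x \<in> S \<Longrightarrow> k' (k x) = x" "\<And>y. y \<in> S' \<Longrightarrow> k (k' y) = y"
    "\<And>x. x \<in> S \<Longrightarrow> k x \<in> S'" "\<And>y. y \<in> S' \<Longrightarrow> k' y \<in> S"
    using k by (auto simp: homeomorphism_def)
  have pC: "p ` C = S" using cov covering_space_imp_surjective by blast
  have eC: "e' ` C' = C" using e by (simp add: homeomorphism_def)
  have kS: "k ` S = S'" using k by (simp add: homeomorphism_def)
  show "continuous_on C' (k \<circ> p \<circ> e')"
  proof (intro continuous_on_compose)
    show "continuous_on C' e'" using e by (simp add: homeomorphism_def)
    show "continuous_on (e' ` C') p" using covering_space_imp_continuous[OF cov] by (simp add: eC)
    show "continuous_on (p ` e' ` C') k" using k by (simp add: homeomorphism_def eC pC)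
  qed
  show "(k \<circ> p \<circ> e') ` C' = S'"
    unfolding image_comp[symmetric] eC pC kS ..
  fix y assume "y \<in> S'"
  then have "k' y \<in> S" by (rule kk)
  then obtain T v where T: "k' y \<in> T" "openin (top_of_set S) T" "\<Union>v = C \<inter> p -` T"
    and v: "\<forall>u \<in> v. openin (top_of_set C) u" "pairwise disjnt v" "\<forall>u \<in> v. \<exists>q. homeomorphism u T p q"
    using cov unfolding covering_space_def by blast
  have TS: "T \<subseteq> S" using T(2) openin_imp_subset by blast
  have vC: "u \<subseteq> C" if "u \<in> v" for u using that v(1) openin_imp_subset by blast
  show "\<exists>T. y \<in> T \<and> openin (top_of_set S') T \<and>
             (\<exists>v. \<Union>v = C' \<inter> (k \<circ> p \<circ> e') -` T \<and> (\<forall>u \<in> v. openin (top_of_set C') u) \<and>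
                  pairwise disjnt v \<and> (\<forall>u \<in> v. \<exists>q. homeomorphism u T (k \<circ> p \<circ> e') q))"
  proof (rule exI[of _ "k ` T"], intro conjI exI[of _ "(`) e ` v"] ballI)
    show "y \<in> k ` T" using T(1) kk \<open>y \<in> S'\<close> by (metis image_eqI)
    show "openin (top_of_set S') (k ` T)" using homeomorphism_imp_open_map[OF k T(2)] .
    show "\<Union>((`) e ` v) = C' \<inter> (k \<circ> p \<circ> e') -` (k ` T)"
    proof -
      have "\<Union>((`) e ` v) = e ` (C \<inter> p -` T)" using T(3) by blast
      also have "\<dots> = C' \<inter> (k \<circ> p \<circ> e') -` (k ` T)"
      proof (intro equalityI subsetI)
        fix z assume "z \<in> e ` (C \<inter> p -` T)"
        then show "z \<in> C' \<inter> (k \<circ> p \<circ> e') -` (k ` T)" using ee by auto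
      next
        fix z assume z: "z \<in> C' \<inter> (k \<circ> p \<circ> e') -` (k ` T)"
        then obtain t where t: "t \<in> T" "k (p (e' z)) = k t" by auto
        have "p (e' z) \<in> S" using z ee(4) pC by blast
        then have "p (e' z) = t" using t kk(1) TS by (metis subsetD)
        then show "z \<in> e ` (C \<inter> p -` T)"
          using z t ee by (intro image_eqI[where x="e' z"]) auto
      qed
      finally show ?thesis .
    qed
    show "openin (top_of_set C') w" if "w \<in> (`) e ` v" for w
      using that v(1) homeomorphism_imp_open_map[OF e] by blast
    show "pairwise disjnt ((`) e ` v)"
      unfolding pairwise_def
    proof (intro ballI impI)
      fix a b assume "a \<in> (`) e ` v" "b \<in> (`) e ` v" "a \<noteq> b"
      then obtain a' b' where ab: "a' \<in> v" "b' \<in> v" "a' \<noteq> b'" "a = e ` a'" "b = e ` b'" by blast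
      have "disjnt a' b'" using v(2) ab by (meson pairwiseD)
      moreover have "inj_on e C" using ee(1) by (rule inj_on_inverseI)
      ultimately show "disjnt a b"
        using ab vC by (metis disjnt_def image_empty inj_on_image_Int)
    qed
    fix w assume "w \<in> (`) e ` v"
    then obtain u where u: "u \<in> v" "w = e ` u" by blast
    obtain q where q: "homeomorphism u T p q" using v(3) u by blast
    have "homeomorphism u w e e'"
      using homeomorphism_of_subsets[OF e vC[OF u(1)] _ u(2)[symmetric]]
      by (metis e homeomorphism_image1 image_mono u(1) vC)
    then have 1: "homeomorphism w u e' e" by (rule homeomorphism_symD)
    have 2: "homeomorphism T (k ` T) k k'"
      using homeomorphism_of_subsets[OF k TS _ refl] kS TS by blast
    have "homeomorphism w (k ` T) (k \<circ> (p \<circ> e')) ((e \<circ> q) \<circ> k')"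
      by (rule homeomorphism_compose[OF homeomorphism_compose[OF 1 q] 2])
    then show "\<exists>q. homeomorphism w (k ` T) (k \<circ> p \<circ> e') q" by (metis comp_assoc)
  qed
qed

text \<open>The lifting theorems of the library are stated for normed vector spaces only.\<close>

lemma covering_space_lift_homotopic_paths_embedded:
  fixes C :: "'a::topological_space set" and S :: "'b::topological_space set"
    and C' :: "'m::real_normed_vector set" and S' :: "'l::real_normed_vector set"
  assumes cov: "covering_space C p S"
    and e: "homeomorphism C C' e e'" and k: "homeomorphism S S' k k'"
    and hom: "homotopic_paths S g1 g2"
    and h1: "path h1" "path_image h1 \<subseteq> C" "\<And>t. t \<in> {0..1} \<Longrightarrow> p (h1 t) = g1 t"
    and h2: "path h2" "path_image h2 \<subseteq> C" "\<And>t. t \<in> {0..1} \<Longrightarrow> p (h2 t) = g2 t"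
    and start: "pathstart h1 = pathstart h2"
  shows "homotopic_paths C h1 h2"
proof -
  have ee: "\<And>x. x \<in> C \<Longrightarrow> e' (e x) = x" and eC: "e ` C = C'" "e' ` C' = C"
    and ce: "continuous_on C e" "continuous_on C' e'"
    using e by (auto simp: homeomorphism_def)
  have kS: "k ` S = S'" and ck: "continuous_on S k" using k by (auto simp: homeomorphism_def)
  have g: "path g1" "path_image g1 \<subseteq> S" "path g2" "path_image g2 \<subseteq> S"
    using hom homotopic_paths_imp_path homotopic_paths_imp_subset by blast+
  have in_C: "h1 t \<in> C" "h2 t \<in> C" if "t \<in> {0..1}" for t
    using h1(2) h2(2) that by (auto simp: path_image_def)
  have "homotopic_paths C' (e \<circ> h1) (e \<circ> h2)"
  proof (rule covering_space_lift_homotopic_paths[OF covering_space_homeomorphic[OF cov e k]])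
    show "path (k \<circ> g1)" "path (k \<circ> g2)"
      using g ck by (auto intro!: path_continuous_image elim: continuous_on_subset)
    show "path (e \<circ> h1)" "path (e \<circ> h2)"
      using h1 h2 ce by (auto intro!: path_continuous_image elim: continuous_on_subset)
    show "path_image (k \<circ> g1) \<subseteq> S'" "path_image (k \<circ> g2) \<subseteq> S'"
      using g kS by (auto simp: path_image_compose)
    show "path_image (e \<circ> h1) \<subseteq> C'" "path_image (e \<circ> h2) \<subseteq> C'"
      using h1 h2 eC by (auto simp: path_image_compose)
    show "homotopic_paths S' (k \<circ> g1) (k \<circ> g2)"
      using homotopic_paths_continuous_image[OF hom ck] kS by blast
    show "pathstart (e \<circ> h1) = pathstart (e \<circ> h2)" using start by (simp add: pathstart_compose)
  qed (use in_C ee h1(3) h2(3) in auto)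
  then have 1: "homotopic_paths C (e' \<circ> (e \<circ> h1)) (e' \<circ> (e \<circ> h2))"
    using homotopic_paths_continuous_image[OF _ ce(2)] eC(2) by blast
  have "homotopic_paths C h1 (e' \<circ> (e \<circ> h1))" "homotopic_paths C h2 (e' \<circ> (e \<circ> h2))"
    using h1 h2 in_C ee by (auto intro!: homotopic_paths_eq)
  with 1 show ?thesis by (metis homotopic_paths_sym homotopic_paths_trans)
qed

section \<open>Fundamental groups\<close>

lemma loop_class_eq_iff:
  assumes "path p" "path_image p \<subseteq> S"
  shows "loop_class S p = loop_class S q \<longleftrightarrow> homotopic_paths S p q"
proof
  assume "loop_class S p = loop_class S q"
  moreover have "p \<in> loop_class S p" using assms by (simp add: loop_class_def)
  ultimately show "homotopic_paths S p q" by (simp add: loop_class_def homotopic_paths_sym)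
qed (auto simp: loop_class_def intro: homotopic_paths_trans homotopic_paths_sym)

lemma induced_map_loop_class:
  assumes F: "continuous_on S F" "F \<in> S \<rightarrow> S'" and p: "path p" "path_image p \<subseteq> S"
  shows "induced_map S' F (loop_class S p) = loop_class S' (F \<circ> p)"
proof -
  have "p \<in> loop_class S p" using p by (simp add: loop_class_def)
  moreover have "homotopic_paths S' (F \<circ> p) (F \<circ> q)" if "q \<in> loop_class S p" for q
    using that homotopic_paths_continuous_image[OF _ F] by (simp add: loop_class_def)
  ultimately show ?thesis
    unfolding induced_map_def loop_class_def[of S'] by (auto intro: homotopic_paths_trans)
qed

lemma mult_loop_class:
  assumes "p \<in> loops_at S x" "q \<in> loops_at S x"
  shows "loop_class S p \<otimes>\<^bsub>fundamental_group S x\<^esub> loop_class S q = loop_class S (p +++ q)"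
proof -
  have pq: "path p" "path_image p \<subseteq> S" "path q" "path_image q \<subseteq> S" "pathfinish p = pathstart q"
    using assms by (auto simp: loops_at_def)
  have "homotopic_paths S (p +++ q) (p' +++ q')" if "p' \<in> loop_class S p" "q' \<in> loop_class S q" for p' q'
    using that pq by (intro homotopic_paths_join) (auto simp: loop_class_def)
  moreover have "p \<in> loop_class S p" "q \<in> loop_class S q"
    using pq by (simp_all add: loop_class_def)
  ultimately show ?thesis
    unfolding fundamental_group_def monoid.simps partial_object.simps loop_class_def[of S "p +++ q"]
    by (auto intro: homotopic_paths_trans)
qed

text \<open>The covering argument yields a statement about paths; \<open>inj\<close> is the form in
  which it enters. The homotopy it starts from may leave the image of \<open>F\<close>.\<close>

lemma induced_map_mon:
  assumes F: "continuous_on S F" "F \<in> S \<rightarrow> S'"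
    and inj: "\<And>p q. p \<in> loops_at S x \<Longrightarrow> q \<in> loops_at S x \<Longrightarrow> homotopic_paths S' (F \<circ> p) (F \<circ> q)
      \<Longrightarrow> homotopic_paths S p q"
  shows "induced_map S' F \<in> mon (fundamental_group S x) (fundamental_group S' (F x))"
proof -
  have carrier: "carrier (fundamental_group T y) = loop_class T ` loops_at T y"
    for T :: "'z::topological_space set" and y
    by (simp add: fundamental_group_def)
  have ind: "induced_map S' F (loop_class S p) = loop_class S' (F \<circ> p)" if "p \<in> loops_at S x" for p
    using that by (intro induced_map_loop_class F) (auto simp: loops_at_def)
  have loop: "F \<circ> p \<in> loops_at S' (F x)" if "p \<in> loops_at S x" for p
  proof -
    have "continuous_on (path_image p) F" using that F by (auto simp: loops_at_def elim: continuous_on_subset)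
    then show ?thesis using that F(2)
      by (fastforce simp: loops_at_def path_image_compose pathstart_compose pathfinish_compose
          intro: path_continuous_image)
  qed
  have join: "p +++ q \<in> loops_at S x" if "p \<in> loops_at S x" "q \<in> loops_at S x" for p q
    using that by (auto simp: loops_at_def path_image_join)
  show ?thesis
    unfolding mon_def hom_def
  proof (intro CollectI conjI ballI)
    show "induced_map S' F \<in> carrier (fundamental_group S x) \<rightarrow> carrier (fundamental_group S' (F x))"
      using ind loop by (auto simp: carrier)
    fix P Q assume "P \<in> carrier (fundamental_group S x)" "Q \<in> carrier (fundamental_group S x)"
    then obtain p q where p: "p \<in> loops_at S x" "P = loop_class S p"
      and q: "q \<in> loops_at S x" "Q = loop_class S q" by (auto simp: carrier)
    show "induced_map S' F (P \<otimes>\<^bsub>fundamental_group S x\<^esub> Q) =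
        induced_map S' F P \<otimes>\<^bsub>fundamental_group S' (F x)\<^esub> induced_map S' F Q"
      using p q by (simp add: mult_loop_class join ind loop path_compose_join)
  next
    show "inj_on (induced_map S' F) (carrier (fundamental_group S x))"
    proof (rule inj_onI)
      fix P Q assume "P \<in> carrier (fundamental_group S x)" "Q \<in> carrier (fundamental_group S x)"
        and eq: "induced_map S' F P = induced_map S' F Q"
      then obtain p q where p: "p \<in> loops_at S x" "P = loop_class S p"
        and q: "q \<in> loops_at S x" "Q = loop_class S q" by (auto simp: carrier)
      have "homotopic_paths S' (F \<circ> p) (F \<circ> q)"
        using eq p q loop[OF p(1)] by (simp add: ind loop_class_eq_iff loops_at_def)
      then have "homotopic_paths S p q" using inj p q by blast
      then show "P = Q" using p q by (simp add: loop_class_eq_iff loops_at_def)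
    qed
  qed
qed

section \<open>Barycentric points and push-forwards\<close>

definition support :: "('v \<Rightarrow> real) \<Rightarrow> 'v set" where
  "support t = {v. t v \<noteq> 0}"

text \<open>Barycentric coordinates without reference to a cell. The carrier of the point, the
  smallest cell that contains it, is read off as its \<open>support\<close>.\<close>

definition weight :: "('v \<Rightarrow> real) \<Rightarrow> bool" where
  "weight t \<longleftrightarrow> finite (support t) \<and> (\<forall>v. 0 \<le> t v) \<and> sum t (support t) = 1"

lemma in_support_iff: "v \<in> support t \<longleftrightarrow> t v \<noteq> 0"
  by (simp add: support_def)

lemma weight_nonneg: "weight t \<Longrightarrow> 0 \<le> t v"
  by (simp add: weight_def)

lemma finite_support: "weight t \<Longrightarrow> finite (support t)"
  by (simp add: weight_def)

lemma support_nonempty: "weight t \<Longrightarrow> support t \<noteq> {}"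
  by (auto simp: weight_def)

lemma sum_over_support:
  assumes "finite A" "support t \<subseteq> A"
  shows "(\<Sum>v\<in>support t. t v * s v) = (\<Sum>v\<in>A. t v * s v)"
  using assms by (intro sum.mono_neutral_left) (auto simp: in_support_iff)

lemma weight_sum:
  assumes "weight t" "finite A" "support t \<subseteq> A"
  shows "sum t A = 1"
  using sum_over_support[OF assms(2,3), of "\<lambda>_. 1"] assms(1) by (simp add: weight_def)

lemma closed_cell_iff_weight:
  assumes "finite \<sigma>"
  shows "t \<in> closed_cell \<sigma> \<longleftrightarrow> weight t \<and> support t \<subseteq> \<sigma>"
proof
  assume t: "t \<in> closed_cell \<sigma>"
  then have sub: "support t \<subseteq> \<sigma>" by (auto simp: closed_cell_def support_def)
  then show "weight t \<and> support t \<subseteq> \<sigma>"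
    using t assms sum_over_support[OF assms sub, of "\<lambda>_. 1"] finite_subset
    by (auto simp: weight_def closed_cell_def)
qed (use weight_sum[OF _ assms] in \<open>auto simp: closed_cell_def weight_nonneg in_support_iff\<close>)

lemma push_forward_sum:
  assumes "finite A" "support t \<subseteq> A"
  shows "push_forward f t w = (\<Sum>v | v \<in> A \<and> f v = w. t v)"
  unfolding push_forward_def
  using assms by (intro sum.mono_neutral_left) (auto simp: in_support_iff)

lemma push_forward_nonneg: "weight t \<Longrightarrow> 0 \<le> push_forward f t w"
  unfolding push_forward_def by (intro sum_nonneg) (auto simp: weight_nonneg)

lemma le_push_forward:
  assumes "weight t"
  shows "t v \<le> push_forward f t (f v)"
proof (cases "t v = 0")
  case False
  have "finite {u. t u \<noteq> 0 \<and> f u = f v}"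
    using finite_support[OF assms] by (rule finite_subset[rotated]) (auto simp: support_def)
  then show ?thesis
    unfolding push_forward_def using False assms by (intro member_le_sum) (auto simp: weight_nonneg)
qed (simp add: push_forward_nonneg assms)

text \<open>Weights are nonnegative, so the contributions of different preimages cannot
  cancel.\<close>

lemma support_push_forward:
  assumes "weight t"
  shows "support (push_forward f t) = f ` support t"
proof (intro equalityI subsetI)
  fix w assume "w \<in> support (push_forward f t)"
  then have "push_forward f t w \<noteq> 0" by (simp add: support_def)
  then have "{v. t v \<noteq> 0 \<and> f v = w} \<noteq> {}" unfolding push_forward_def by (metis sum.empty)
  then show "w \<in> f ` support t" by (auto simp: support_def)
next
  fix w assume "w \<in> f ` support t"
  then obtain v where "v \<in> support t" "w = f v" by blast
  then show "w \<in> support (push_forward f t)"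
    using le_push_forward[OF assms, of v f] weight_nonneg[OF assms, of v] by (auto simp: support_def)
qed

text \<open>Change of variables for finite sums. With \<open>s\<close> constant it preserves total
  weight, with \<open>s\<close> an indicator it gives functoriality, and with
  \<open>s = side\<close> it computes \<open>coord\<close>.\<close>

lemma sum_push_forward:
  assumes "weight t"
  shows "(\<Sum>w\<in>support (push_forward f t). push_forward f t w * s w) = (\<Sum>v\<in>support t. t v * s (f v))"
proof -
  have fin: "finite (support t)" using assms by (rule finite_support)
  have "(\<Sum>v\<in>support t. t v * s (f v)) = (\<Sum>w\<in>f ` support t. \<Sum>v | v \<in> support t \<and> f v = w. t v * s (f v))"
    using fin by (rule sum.image_gen)
  also have "\<dots> = (\<Sum>w\<in>f ` support t. push_forward f t w * s w)"
    by (intro sum.cong refl) (auto simp: push_forward_sum[OF fin] sum_distrib_right intro!: sum.cong)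
  finally show ?thesis by (simp add: support_push_forward assms)
qed

lemma weight_push_forward:
  assumes "weight t"
  shows "weight (push_forward f t)"
  using assms sum_push_forward[OF assms, of f "\<lambda>_. 1"]
  by (simp add: weight_def support_push_forward push_forward_nonneg)

lemma push_forward_push_forward:
  assumes "weight t"
  shows "push_forward g (push_forward f t) = push_forward (g \<circ> f) t"
proof
  fix w
  have fin: "finite (support t)" using assms by (rule finite_support)
  define s where "s = (\<lambda>v. if g v = w then 1 else 0 :: real)"
  have *: "push_forward h r w' = (\<Sum>v\<in>support r. r v * (if h v = w' then 1 else 0))" if "weight r"
    for h :: "'p \<Rightarrow> 'q" and r w'
    unfolding push_forward_sum[OF finite_support[OF that] order_refl]
    by (simp add: sum.inter_filter[OF finite_support[OF that]] if_distrib cong: if_cong)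
  have "push_forward g (push_forward f t) w = (\<Sum>v\<in>support t. t v * s (f v))"
    unfolding *[OF weight_push_forward[OF assms]] s_def[symmetric]
    using sum_push_forward[OF assms, of f s] by (simp add: s_def)
  also have "\<dots> = push_forward (g \<circ> f) t w"
    unfolding *[OF assms] by (simp add: s_def)
  finally show "push_forward g (push_forward f t) w = push_forward (g \<circ> f) t w" .
qed

lemma push_forward_ident:
  assumes "\<And>v. v \<in> support t \<Longrightarrow> f v = v"
  shows "push_forward f t = t"
proof
  fix w
  have "{v. t v \<noteq> 0 \<and> f v = w} = (if t w = 0 then {} else {w})"
    using assms by (auto simp: in_support_iff)
  then show "push_forward f t w = t w" by (simp add: push_forward_def)
qed

section \<open>Points of product complexes and factorwise affine maps\<close>

definition push_point :: "nat \<Rightarrow> (nat \<Rightarrow> 'v \<Rightarrow> 'w) \<Rightarrow> (nat \<Rightarrow> 'v \<Rightarrow> real) \<Rightarrow> nat \<Rightarrow> 'w \<Rightarrow> real" where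
  "push_point n f p = (\<lambda>i\<in>{1..n}. push_forward (f i) (p i))"

text \<open>A complex is given by the families of carriers that it allows. This common format serves
  the source, the target and the completion, so every map between them is a
  \<open>push_point\<close> and is checked on supports only.\<close>

definition points :: "nat \<Rightarrow> ((nat \<Rightarrow> 'v set) \<Rightarrow> bool) \<Rightarrow> (nat \<Rightarrow> 'v \<Rightarrow> real) set" where
  "points n Q = {p \<in> extensional {1..n}. (\<forall>i\<in>{1..n}. weight (p i)) \<and> Q (\<lambda>i. support (p i))}"

text \<open>An extensional point is \<open>undefined\<close> outside \<open>{1..n}\<close> and has
  an arbitrary support there; \<open>Q\<close> must not see it.\<close>

definition local_family :: "nat \<Rightarrow> ((nat \<Rightarrow> 'v set) \<Rightarrow> bool) \<Rightarrow> bool" where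
  "local_family n Q \<longleftrightarrow> (\<forall>S T. (\<forall>i\<in>{1..n}. S i = T i) \<longrightarrow> Q S = Q T)"

definition finite_family :: "nat \<Rightarrow> ((nat \<Rightarrow> 'v set) \<Rightarrow> bool) \<Rightarrow> bool" where
  "finite_family n Q \<longleftrightarrow> (\<forall>i\<in>{1..n}. finite (\<Union>S\<in>Collect Q. S i))"

lemma weight_points: "p \<in> points n Q \<Longrightarrow> i \<in> {1..n} \<Longrightarrow> weight (p i)"
  by (simp add: points_def)

lemma supports_points: "p \<in> points n Q \<Longrightarrow> Q (\<lambda>i. support (p i))"
  by (simp add: points_def)

lemma support_push_point:
  "i \<in> {1..n} \<Longrightarrow> weight (p i) \<Longrightarrow> support (push_point n f p i) = f i ` support (p i)"
  by (simp add: push_point_def support_push_forward)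

lemma push_point_in_points:
  assumes p: "p \<in> points n Q" and Q': "local_family n Q'"
    and im: "Q' (\<lambda>i. f i ` support (p i))"
  shows "push_point n f p \<in> points n Q'"
proof -
  have "Q' (\<lambda>i. support (push_point n f p i)) = Q' (\<lambda>i. f i ` support (p i))"
    by (rule Q'[unfolded local_family_def, rule_format]) (simp add: support_push_point weight_points[OF p])
  then show ?thesis
    using im weight_points[OF p] by (auto simp: points_def push_point_def weight_push_forward)
qed

lemma push_point_push_point:
  assumes "p \<in> points n Q"
  shows "push_point n g (push_point n f p) = push_point n (\<lambda>i. g i \<circ> f i) p"
  using weight_points[OF assms]
  by (simp add: push_point_def push_forward_push_forward cong: restrict_cong)

lemma push_point_ident:
  assumes "p \<in> points n Q" "\<And>i v. i \<in> {1..n} \<Longrightarrow> v \<in> support (p i) \<Longrightarrow> f i v = v"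
  shows "push_point n f p = p"
proof (rule extensionalityI)
  show "push_point n f p \<in> extensional {1..n}" by (simp add: push_point_def)
  show "p \<in> extensional {1..n}" using assms(1) by (simp add: points_def)
  show "push_point n f p i = p i" if "i \<in> {1..n}" for i
    using that assms(2)[OF that] by (simp add: push_point_def push_forward_ident)
qed

lemma continuous_on_coordinate: "continuous_on A (\<lambda>p :: nat \<Rightarrow> 'v \<Rightarrow> real. p i v)"
  by (rule continuous_on_subset[OF _ subset_UNIV], rule continuous_on_product_then_coordinatewise,
      rule continuous_on_product_coordinates)

text \<open>The index set of the sum in \<open>push_forward\<close> varies with the point.
  Finiteness of the family allows it to be replaced by a fixed finite set, which leaves a finite sum
  of coordinates.\<close>

lemma continuous_on_push_point:
  assumes "finite_family n Q"
  shows "continuous_on (points n Q) (push_point n f)"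
proof (intro continuous_on_coordinatewise_then_product)
  fix i w
  show "continuous_on (points n Q) (\<lambda>p. push_point n f p i w)"
  proof (cases "i \<in> {1..n}")
    case True
    define K where "K = (\<Union>S\<in>Collect Q. S i)"
    have K: "finite K" using assms True by (simp add: finite_family_def K_def)
    have "support (p i) \<subseteq> K" if "p \<in> points n Q" for p
      using supports_points[OF that] by (auto simp: K_def)
    then have "push_point n f p i w = (\<Sum>v | v \<in> K \<and> f i v = w. p i v)" if "p \<in> points n Q" for p
      using that True by (simp add: push_point_def push_forward_sum[OF K])
    moreover have "continuous_on (points n Q) (\<lambda>p. \<Sum>v | v \<in> K \<and> f i v = w. p i v)"
      by (intro continuous_on_sum continuous_on_coordinate)
    ultimately show ?thesis by (simp cong: continuous_on_cong)
  next
    case False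
    then have "(\<lambda>p. push_point n f p i w) = (\<lambda>p. undefined w)" by (auto simp: push_point_def)
    then show ?thesis by (simp only: continuous_on_const)
  qed
qed

section \<open>Embedding a complex into a normed space\<close>

lemma apply_bcontfun_sum: "apply_bcontfun (sum f A) x = (\<Sum>a\<in>A. apply_bcontfun (f a) x)"
  by (induction A rule: infinite_finite_induct) (auto simp: zero_bcontfun.rep_eq plus_bcontfun.rep_eq)

lemma continuous_on_apply_bcontfun_at: "continuous_on A (\<lambda>f. apply_bcontfun f x)"
proof (rule continuous_onI)
  fix f e assume "(0::real) < e"
  then show "\<exists>d>0. \<forall>g\<in>A. dist g f < d \<longrightarrow> dist (apply_bcontfun g x) (apply_bcontfun f x) \<le> e"
    by (meson dist_bounded less_imp_le order_trans)
qed

text \<open>Only finitely many barycentric coordinates can be nonzero. Numbered by \<open>g\<close>,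
  they become the values of a bounded function on the natural numbers. This one normed space has
  room for every finite number of coordinates, so the dimension does not enter the type.\<close>

lemma points_embedding:
  fixes Q :: "(nat \<Rightarrow> 'v set) \<Rightarrow> bool"
  assumes "finite_family n Q"
  shows "\<exists>(E :: (nat \<Rightarrow>\<^sub>C real) set) e e'. homeomorphism (points n Q) E e e'"
proof -
  define K where "K = (SIGMA i:{1..n}. \<Union>S\<in>Collect Q. S i)"
  have K: "finite K" using assms by (auto simp: K_def finite_family_def)
  then obtain g :: "nat \<times> 'v \<Rightarrow> nat" where g: "inj_on g K"
    using finite_imp_inj_to_nat_seg by metis
  define \<delta> :: "nat \<Rightarrow> nat \<Rightarrow>\<^sub>C real" where "\<delta> m = Bcontfun (\<lambda>k. if k = m then 1 else 0)" for m
  have \<delta>: "apply_bcontfun (\<delta> m) k = (if k = m then 1 else 0)" for m k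
  proof -
    have "bounded (range (\<lambda>k. if k = m then 1 else 0 :: real))"
      by (rule bounded_subset[of "{0,1}"]) auto
    then have "(\<lambda>k. if k = m then 1 else 0 :: real) \<in> bcontfun" by (simp add: bcontfun_def)
    then show ?thesis by (simp add: \<delta>_def Bcontfun_inverse)
  qed
  define e where "e p = (\<Sum>a\<in>K. p (fst a) (snd a) *\<^sub>R \<delta> (g a))" for p :: "nat \<Rightarrow> 'v \<Rightarrow> real"
  define e' where "e' y = (\<lambda>i\<in>{1..n}. \<lambda>v. if (i, v) \<in> K then apply_bcontfun y (g (i, v)) else 0)"
    for y :: "nat \<Rightarrow>\<^sub>C real"
  have e_apply: "apply_bcontfun (e p) (g a) = p (fst a) (snd a)" if "a \<in> K" for p a
  proof -
    have "apply_bcontfun (e p) (g a) = (\<Sum>b\<in>K. if b = a then p (fst b) (snd b) else 0)"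
      unfolding e_def apply_bcontfun_sum
      using g that by (intro sum.cong) (auto simp: scaleR_bcontfun.rep_eq \<delta> inj_on_def)
    then show ?thesis using K that by simp
  qed
  have inv: "e' (e p) = p" if p: "p \<in> points n Q" for p
  proof (rule extensionalityI)
    show "e' (e p) \<in> extensional {1..n}" by (simp add: e'_def)
    show "p \<in> extensional {1..n}" using p by (simp add: points_def)
    fix i assume i: "i \<in> {1..n}"
    have "p i v = 0" if "(i, v) \<notin> K" for v
      using that supports_points[OF p] i by (auto simp: K_def support_def)
    then show "e' (e p) i = p i" using i by (auto simp: e'_def e_apply)
  qed
  have "homeomorphism (points n Q) (e ` points n Q) e e'"
  proof (rule homeomorphismI)
    show "continuous_on (points n Q) e" unfolding e_def
      by (intro continuous_on_sum continuous_on_scaleR continuous_on_coordinate continuous_on_const)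
    show "continuous_on (e ` points n Q) e'"
    proof (intro continuous_on_coordinatewise_then_product)
      fix i v
      show "continuous_on (e ` points n Q) (\<lambda>y. e' y i v)"
        by (cases "i \<in> {1..n}"; cases "(i, v) \<in> K") (auto simp: e'_def continuous_on_apply_bcontfun_at)
    qed
  qed (use inv in auto)
  then show ?thesis by blast
qed

section \<open>Cells of a product of graphs\<close>

text \<open>By flagness, whether a product cell belongs to a coupled link complex can be read off from pairs
  of vertices of different factors; \<open>adj\<close> stands for this compatibility of vertices.\<close>

definition product_cell ::
  "nat \<Rightarrow> (nat \<Rightarrow> 'v set set) \<Rightarrow> ('v \<Rightarrow> 'v \<Rightarrow> bool) \<Rightarrow> (nat \<Rightarrow> 'v set) \<Rightarrow> bool" where
  "product_cell n G adj S \<longleftrightarrow> (\<forall>i\<in>{1..n}. S i \<in> G i \<and>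
     (\<forall>j\<in>{1..n}. j \<noteq> i \<longrightarrow> (\<forall>u\<in>S i. \<forall>v\<in>S j. adj u v)))"

text \<open>Forgets the two sides of the join graphs. The bound on dimension survives as
  \<open>cell_eq\<close>, which makes every cell a vertex or an edge.\<close>

locale graph_product =
  fixes n :: nat and G :: "nat \<Rightarrow> 'v set set" and adj :: "'v \<Rightarrow> 'v \<Rightarrow> bool"
  assumes cell_nonempty: "\<And>i S. S \<in> G i \<Longrightarrow> S \<noteq> {}"
    and cell_subset: "\<And>i S T. S \<in> G i \<Longrightarrow> T \<subseteq> S \<Longrightarrow> T \<noteq> {} \<Longrightarrow> T \<in> G i"
    and cell_eq: "\<And>i S u v. S \<in> G i \<Longrightarrow> u \<in> S \<Longrightarrow> v \<in> S \<Longrightarrow> u \<noteq> v \<Longrightarrow> S = {u, v}"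
    and finite_graph: "\<And>i. finite (\<Union>(G i))"
    and adj_sym: "\<And>u v. adj u v \<Longrightarrow> adj v u"
begin

abbreviation "pcell \<equiv> product_cell n G adj"

lemma finite_cell: "S \<in> G i \<Longrightarrow> finite S"
  using finite_graph[of i] by (meson Union_upper finite_subset)

lemma pcell_subset:
  assumes "pcell S" "\<And>i. i \<in> {1..n} \<Longrightarrow> T i \<subseteq> S i" "\<And>i. i \<in> {1..n} \<Longrightarrow> T i \<noteq> {}"
  shows "pcell T"
  unfolding product_cell_def
proof (intro ballI conjI impI)
  show "T i \<in> G i" if i: "i \<in> {1..n}" for i
  proof (rule cell_subset)
    show "S i \<in> G i" using assms(1) i by (simp add: product_cell_def)
  qed (use assms(2,3) i in auto)
  show "adj u v" if "i \<in> {1..n}" "j \<in> {1..n}" "j \<noteq> i" "u \<in> T i" "v \<in> T j" for i j u v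
  proof -
    have "u \<in> S i" "v \<in> S j" using assms(2) that by (meson subsetD)+
    then show ?thesis using assms(1) that(1-3) by (simp add: product_cell_def)
  qed
qed

lemma local_family_pcell: "local_family n pcell"
  unfolding local_family_def product_cell_def by auto

lemma finite_family_pcell: "finite_family n pcell"
  unfolding finite_family_def
proof
  fix i assume "i \<in> {1..n}"
  then have "(\<Union>S\<in>Collect pcell. S i) \<subseteq> \<Union>(G i)" unfolding product_cell_def by blast
  then show "finite (\<Union>S\<in>Collect pcell. S i)" using finite_graph by (rule finite_subset)
qed

end

section \<open>Coupled link complexes\<close>

fun compatible :: "'a set set \<Rightarrow> 'b set set \<Rightarrow> 'a + 'b \<Rightarrow> 'a + 'b \<Rightarrow> bool" where
  "compatible K L (Inl a) (Inl a') = ({a, a'} \<in> K)"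
| "compatible K L (Inr b) (Inr b') = ({b, b'} \<in> L)"
| "compatible K L _ _ = True"

abbreviation link_graph :: "'a coloured_complex \<Rightarrow> 'b coloured_complex \<Rightarrow> nat \<Rightarrow> ('a + 'b) set set" where
  "link_graph \<Gamma>A \<Gamma>B i \<equiv> join_cells (colour_class \<Gamma>A i) (colour_class \<Gamma>B i)"

abbreviation link_cell :: "nat \<Rightarrow> 'a coloured_complex \<Rightarrow> 'b coloured_complex \<Rightarrow> (nat \<Rightarrow> ('a + 'b) set) \<Rightarrow> bool" where
  "link_cell n \<Gamma>A \<Gamma>B \<equiv>
     product_cell n (link_graph \<Gamma>A \<Gamma>B) (compatible (simplices \<Gamma>A) (simplices \<Gamma>B))"

text \<open>At most one vertex on each side: in this form the condition visibly passes to nonempty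
  subsets.\<close>

lemma join_cells_iff:
  "T \<in> join_cells A B \<longleftrightarrow> T \<noteq> {} \<and> T \<subseteq> Inl ` A \<union> Inr ` B \<and>
     (\<forall>a a'. Inl a \<in> T \<longrightarrow> Inl a' \<in> T \<longrightarrow> a = a') \<and> (\<forall>b b'. Inr b \<in> T \<longrightarrow> Inr b' \<in> T \<longrightarrow> b = b')"
  (is "_ \<longleftrightarrow> ?R")
proof
  assume R: ?R
  then have T: "u \<in> Inl ` A \<union> Inr ` B" if "u \<in> T" for u using that by (meson subsetD)
  obtain u where u: "u \<in> T" using R by auto
  consider a b where "Inl a \<in> T" "Inr b \<in> T" | a where "Inl a \<in> T" "\<And>b. Inr b \<notin> T"
    | b where "Inr b \<in> T" "\<And>a. Inl a \<notin> T"
    using u by (cases u) metis+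
  then show "T \<in> join_cells A B"
  proof cases
    case (1 a b)
    have "u = Inl a \<or> u = Inr b" if "u \<in> T" for u using that R 1 by (cases u) auto
    then have "T = {Inl a, Inr b}" using 1 by blast
    then show ?thesis using T[OF 1(1)] T[OF 1(2)] by (auto simp: join_cells_def)
  next
    case (2 a)
    have "u = Inl a" if "u \<in> T" for u using that R 2 by (cases u) auto
    then have "T = {Inl a}" using 2 by blast
    then show ?thesis using T[OF 2(1)] by (auto simp: join_cells_def)
  next
    case (3 b)
    have "u = Inr b" if "u \<in> T" for u using that R 3 by (cases u) auto
    then have "T = {Inr b}" using 3 by blast
    then show ?thesis using T[OF 3(1)] by (auto simp: join_cells_def)
  qed
qed (auto simp: join_cells_def)

lemma join_cells_subset:
  assumes "S \<in> join_cells A B" "T \<subseteq> S" "T \<noteq> {}"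
  shows "T \<in> join_cells A B"
proof -
  note S = assms(1)[unfolded join_cells_iff]
  have T: "u \<in> S" if "u \<in> T" for u using assms(2) that by (rule subsetD)
  show ?thesis
    unfolding join_cells_iff
  proof (intro conjI allI impI)
    show "T \<subseteq> Inl ` A \<union> Inr ` B" using assms(2) S by (metis subset_trans)
  qed (use assms(3) S T in \<open>simp_all\<close>)
qed

lemma join_cell_eq:
  assumes "T \<in> join_cells A B" "u \<in> T" "v \<in> T" "u \<noteq> v"
  shows "T = {u, v}"
  using assms unfolding join_cells_def by auto

lemma finite_vertices:
  assumes "simplicial_complex K"
  shows "finite (vertices K)"
proof -
  have "finite (\<Union>K)" using assms by (auto simp: simplicial_complex_def)
  moreover have "vertices K \<subseteq> \<Union>K" by (auto simp: vertices_def)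
  ultimately show ?thesis by (rule finite_subset[rotated])
qed

lemma simplex_subset: "simplicial_complex K \<Longrightarrow> \<sigma> \<in> K \<Longrightarrow> \<tau> \<subseteq> \<sigma> \<Longrightarrow> \<tau> \<in> K"
  by (auto simp: simplicial_complex_def)

lemma is_coloured_simplicial: "is_coloured n \<Gamma> \<Longrightarrow> simplicial_complex (simplices \<Gamma>)"
  by (simp add: is_coloured_def)

lemma flag_complexD:
  assumes "flag_complex K" "\<sigma> \<subseteq> vertices K"
    "\<And>u v. u \<in> \<sigma> \<Longrightarrow> v \<in> \<sigma> \<Longrightarrow> u \<noteq> v \<Longrightarrow> {u, v} \<in> K"
  shows "\<sigma> \<in> K"
proof (rule assms(1)[unfolded flag_complex_def, rule_format], intro conjI ballI impI)
qed (use assms(2,3) in blast)+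

lemma graph_product_link:
  assumes "is_coloured n \<Gamma>A" "is_coloured n \<Gamma>B"
  shows "graph_product (link_graph \<Gamma>A \<Gamma>B) (compatible (simplices \<Gamma>A) (simplices \<Gamma>B))"
proof
  show "S \<noteq> {}" if "S \<in> link_graph \<Gamma>A \<Gamma>B i" for i S
    using that by (simp add: join_cells_iff)
  show "T \<in> link_graph \<Gamma>A \<Gamma>B i" if "S \<in> link_graph \<Gamma>A \<Gamma>B i" "T \<subseteq> S" "T \<noteq> {}" for i S T
    using that by (rule join_cells_subset)
  show "S = {u, v}" if "S \<in> link_graph \<Gamma>A \<Gamma>B i" "u \<in> S" "v \<in> S" "u \<noteq> v" for i S u v
    using that by (rule join_cell_eq)
  show "finite (\<Union>(link_graph \<Gamma>A \<Gamma>B i))" for i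
  proof (rule finite_subset)
    show "\<Union>(link_graph \<Gamma>A \<Gamma>B i) \<subseteq> Inl ` vertices (simplices \<Gamma>A) \<union> Inr ` vertices (simplices \<Gamma>B)"
      by (auto simp: join_cells_def colour_class_def)
    show "finite (Inl ` vertices (simplices \<Gamma>A) \<union> Inr ` vertices (simplices \<Gamma>B))"
      using assms by (simp add: finite_vertices is_coloured_simplicial)
  qed
  show "compatible (simplices \<Gamma>A) (simplices \<Gamma>B) v u" if "compatible (simplices \<Gamma>A) (simplices \<Gamma>B) u v" for u v
    using that by (cases u; cases v) (auto simp: insert_commute)
qed

text \<open>Two vertices of a cube in different factors occur together in some vertex of the cube,
  which gives pairwise compatibility. Conversely, flagness assembles the simplices
  \<open>A_part\<close> and \<open>B_part\<close> from their pairs.\<close>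

lemma coupled_link_complex_eq:
  assumes A: "is_coloured n \<Gamma>A" "flag_complex (simplices \<Gamma>A)"
    and B: "is_coloured n \<Gamma>B" "flag_complex (simplices \<Gamma>B)"
  shows "coupled_link_complex n \<Gamma>A \<Gamma>B = {E \<in> extensional {1..n}. link_cell n \<Gamma>A \<Gamma>B E}"
proof (intro equalityI subsetI)
  fix E assume E: "E \<in> coupled_link_complex n \<Gamma>A \<Gamma>B"
  then have Ei: "E i \<in> link_graph \<Gamma>A \<Gamma>B i" if "i \<in> {1..n}" for i
    using that by (auto simp: coupled_link_complex_def ambient_cubes_def)
  have "compatible (simplices \<Gamma>A) (simplices \<Gamma>B) u v"
    if ij: "i \<in> {1..n}" "j \<in> {1..n}" "j \<noteq> i" and uv: "u \<in> E i" "v \<in> E j" for i j u v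
  proof -
    \<comment> \<open>A vertex of the cube through \<open>u\<close> and \<open>v\<close>, with
      arbitrary other entries. If \<open>u\<close> and \<open>v\<close> are on the same side, its
      part on that side is a simplex containing both.\<close>
    define x where "x = (\<lambda>k\<in>{1..n}. if k = i then u else if k = j then v else SOME w. w \<in> E k)"
    have "x \<in> PiE {1..n} E"
      using uv Ei by (auto simp: x_def join_cells_iff some_in_eq)
    then have "x \<in> link_vertices n \<Gamma>A \<Gamma>B" using E by (auto simp: coupled_link_complex_def)
    then have AB: "A_part n x \<in> simplices \<Gamma>A" "B_part n x \<in> simplices \<Gamma>B"
      by (auto simp: link_vertices_def)
    have x: "x i = u" "x j = v" using ij by (auto simp: x_def)
    show ?thesis
    proof (cases u; cases v)
      fix a a' assume uv: "u = Inl a" "v = Inl a'"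
      then have "{a, a'} \<subseteq> A_part n x" using x ij by (auto simp: A_part_def)
      then show ?thesis using AB(1) simplex_subset[OF is_coloured_simplicial[OF A(1)]] uv by simp
    next
      fix b b' assume uv: "u = Inr b" "v = Inr b'"
      then have "{b, b'} \<subseteq> B_part n x" using x ij by (auto simp: B_part_def)
      then show ?thesis using AB(2) simplex_subset[OF is_coloured_simplicial[OF B(1)]] uv by simp
    qed auto
  qed
  then show "E \<in> {E \<in> extensional {1..n}. link_cell n \<Gamma>A \<Gamma>B E}"
    using E Ei by (auto simp: product_cell_def coupled_link_complex_def ambient_cubes_def PiE_def)
next
  fix E assume "E \<in> {E \<in> extensional {1..n}. link_cell n \<Gamma>A \<Gamma>B E}"
  then have ext: "E \<in> extensional {1..n}" and E: "link_cell n \<Gamma>A \<Gamma>B E" by auto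
  have Ei: "E i \<in> link_graph \<Gamma>A \<Gamma>B i" if "i \<in> {1..n}" for i
    using E that by (simp add: product_cell_def)
  have "x \<in> link_vertices n \<Gamma>A \<Gamma>B" if x: "x \<in> PiE {1..n} E" for x
  proof -
    have xi: "x i \<in> E i" if "i \<in> {1..n}" for i using x that by auto
    have xi': "x i \<in> Inl ` colour_class \<Gamma>A i \<union> Inr ` colour_class \<Gamma>B i" if "i \<in> {1..n}" for i
      using Ei[OF that] xi[OF that] unfolding join_cells_iff by (meson subsetD)
    have adj: "compatible (simplices \<Gamma>A) (simplices \<Gamma>B) (x i) (x j)"
      if "i \<in> {1..n}" "j \<in> {1..n}" "j \<noteq> i" for i j
      using E xi that unfolding product_cell_def by blast
    have "A_part n x \<in> simplices \<Gamma>A"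
    proof (rule flag_complexD[OF A(2)])
      show "A_part n x \<subseteq> vertices (simplices \<Gamma>A)"
        using xi' by (fastforce simp: A_part_def colour_class_def)
      fix a a' assume *: "a \<in> A_part n x" "a' \<in> A_part n x" "a \<noteq> a'"
      then obtain i j where ij: "i \<in> {1..n}" "x i = Inl a" "j \<in> {1..n}" "x j = Inl a'"
        unfolding A_part_def by blast
      \<comment> \<open>For \<open>j = i\<close> both vertices would be the single entry
        \<open>x i\<close>, against \<open>a \<noteq> a'\<close>.\<close>
      show "{a, a'} \<in> simplices \<Gamma>A" using adj[of i j] *(3) ij by (cases "j = i") auto
    qed
    moreover have "B_part n x \<in> simplices \<Gamma>B"
    proof (rule flag_complexD[OF B(2)])
      show "B_part n x \<subseteq> vertices (simplices \<Gamma>B)"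
        using xi' by (fastforce simp: B_part_def colour_class_def)
      fix b b' assume *: "b \<in> B_part n x" "b' \<in> B_part n x" "b \<noteq> b'"
      then obtain i j where ij: "i \<in> {1..n}" "x i = Inr b" "j \<in> {1..n}" "x j = Inr b'"
        unfolding B_part_def by blast
      show "{b, b'} \<in> simplices \<Gamma>B" using adj[of i j] *(3) ij by (cases "j = i") auto
    qed
    moreover have "x \<in> ambient_vertices n \<Gamma>A \<Gamma>B"
      using x xi' unfolding ambient_vertices_def PiE_iff by blast
    ultimately show ?thesis by (simp add: link_vertices_def)
  qed
  then show "E \<in> coupled_link_complex n \<Gamma>A \<Gamma>B"
    using ext Ei by (auto simp: coupled_link_complex_def ambient_cubes_def PiE_def)
qed

lemma closed_cube_iff:
  assumes "\<And>i. i \<in> {1..n} \<Longrightarrow> finite (E i)"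
  shows "p \<in> closed_cube n E \<longleftrightarrow>
    p \<in> extensional {1..n} \<and> (\<forall>i\<in>{1..n}. weight (p i) \<and> support (p i) \<subseteq> E i)"
  using assms by (auto simp: closed_cube_def PiE_iff closed_cell_iff_weight)

lemma realization_link:
  assumes A: "is_coloured n \<Gamma>A" "flag_complex (simplices \<Gamma>A)"
    and B: "is_coloured n \<Gamma>B" "flag_complex (simplices \<Gamma>B)"
  shows "realization n (coupled_link_complex n \<Gamma>A \<Gamma>B) = points n (link_cell n \<Gamma>A \<Gamma>B)"
proof (intro equalityI subsetI)
  interpret graph_product n "link_graph \<Gamma>A \<Gamma>B" "compatible (simplices \<Gamma>A) (simplices \<Gamma>B)"
    by (rule graph_product_link[OF A(1) B(1)])
  note eq = coupled_link_complex_eq[OF A B]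
  have fin: "finite (E i)" if "link_cell n \<Gamma>A \<Gamma>B E" "i \<in> {1..n}" for E i
    using that finite_cell unfolding product_cell_def by blast
  {
    fix p assume "p \<in> realization n (coupled_link_complex n \<Gamma>A \<Gamma>B)"
    then obtain E where E: "link_cell n \<Gamma>A \<Gamma>B E" and p: "p \<in> closed_cube n E"
      by (auto simp: realization_def eq)
    have p: "p \<in> extensional {1..n} \<and> (\<forall>i\<in>{1..n}. weight (p i) \<and> support (p i) \<subseteq> E i)"
      by (rule iffD1[OF closed_cube_iff[OF fin[OF E]] p])
    moreover have "link_cell n \<Gamma>A \<Gamma>B (\<lambda>i. support (p i))"
      by (rule pcell_subset[OF E]) (simp_all add: p support_nonempty)
    ultimately show "p \<in> points n (link_cell n \<Gamma>A \<Gamma>B)" by (simp add: points_def)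
  next
    fix p assume p: "p \<in> points n (link_cell n \<Gamma>A \<Gamma>B)"
    \<comment> \<open>The carrier of \<open>p\<close>, the smallest cube that contains it.\<close>
    define E where "E = (\<lambda>i\<in>{1..n}. support (p i))"
    have E: "link_cell n \<Gamma>A \<Gamma>B E"
      using pcell_subset[OF supports_points[OF p], of E] weight_points[OF p] support_nonempty
      by (auto simp: E_def)
    then have "E \<in> coupled_link_complex n \<Gamma>A \<Gamma>B" by (simp add: eq E_def)
    moreover have "p \<in> closed_cube n E"
      by (rule iffD2[OF closed_cube_iff[OF fin[OF E]]]) (use p in \<open>simp_all add: E_def points_def\<close>)
    ultimately show "p \<in> realization n (coupled_link_complex n \<Gamma>A \<Gamma>B)"
      by (auto simp: realization_def)
  }
qed

section \<open>The induced cubical map\<close>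

definition side :: "'a + 'b \<Rightarrow> real" where
  "side v = (case v of Inl _ \<Rightarrow> 0 | Inr _ \<Rightarrow> 1)"

lemma side_simps [simp]: "side (Inl a) = 0" "side (Inr b) = 1" "side (map_sum f g v) = side v"
  by (simp_all add: side_def split: sum.split)

text \<open>As the mean value of \<open>side\<close>, a coordinate is accessible to
  \<open>sum_push_forward\<close>.\<close>

lemma coord_eq:
  assumes "weight (p i)"
  shows "coord p i = (\<Sum>v\<in>support (p i). p i v * side v)"
proof -
  have "coord p i = (\<Sum>v\<in>Inr ` {b. p i (Inr b) \<noteq> 0}. p i v * side v)"
    unfolding coord_def by (subst sum.reindex) auto
  also have "\<dots> = (\<Sum>v\<in>support (p i). p i v * side v)"
  proof (rule sum.mono_neutral_left)
    show "finite (support (p i))" using assms by (rule finite_support)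
    show "Inr ` {b. p i (Inr b) \<noteq> 0} \<subseteq> support (p i)" by (auto simp: support_def)
    show "\<forall>v\<in>support (p i) - Inr ` {b. p i (Inr b) \<noteq> 0}. p i v * side v = 0"
    proof
      fix v assume "v \<in> support (p i) - Inr ` {b. p i (Inr b) \<noteq> 0}"
      then show "p i v * side v = 0" by (cases v) (auto simp: support_def)
    qed
  qed
  finally show ?thesis .
qed

lemma coord_push_point:
  assumes "i \<in> {1..n}" "weight (p i)"
  shows "coord (push_point n f p) i = (\<Sum>v\<in>support (p i). p i v * side (f i v))"
proof -
  have "push_point n f p i = push_forward (f i) (p i)" using assms(1) by (simp add: push_point_def)
  then show ?thesis
    using coord_eq[of "push_point n f p" i] assms(2) by (simp add: weight_push_forward sum_push_forward)
qed

lemma coord_push_point_eq: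
  assumes "i \<in> {1..n}" "weight (p i)" "\<And>v. v \<in> support (p i) \<Longrightarrow> side (f i v) = side v"
  shows "coord (push_point n f p) i = coord p i"
  using assms by (simp add: coord_push_point coord_eq)

lemma coupled_map_eq: "coupled_map n fA fB = push_point n (\<lambda>_. map_sum fA fB)"
  by (simp add: coupled_map_def push_point_def fun_eq_iff)

lemma colour_class_coloured_map:
  assumes "coloured_map \<Gamma> \<Gamma>' f" "v \<in> colour_class \<Gamma> i"
  shows "f v \<in> colour_class \<Gamma>' i"
proof -
  have v: "{v} \<in> simplices \<Gamma>" "colour \<Gamma> v = i" using assms(2) by (auto simp: colour_class_def vertices_def)
  then have "f ` {v} \<in> simplices \<Gamma>'"
    using assms(1) unfolding coloured_map_def simplicial_map_def by blast
  then show ?thesis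
    using assms v by (simp add: colour_class_def coloured_map_def vertices_def)
qed

lemma edge_coloured_map:
  assumes "coloured_map \<Gamma> \<Gamma>' f" "{u, v} \<in> simplices \<Gamma>"
  shows "{f u, f v} \<in> simplices \<Gamma>'"
proof -
  have "f ` {u, v} \<in> simplices \<Gamma>'"
    using assms unfolding coloured_map_def simplicial_map_def by blast
  then show ?thesis by simp
qed

lemma join_cells_cases:
  assumes "T \<in> join_cells A B"
  obtains a where "a \<in> A" "T = {Inl a}" | b where "b \<in> B" "T = {Inr b}"
    | a b where "a \<in> A" "b \<in> B" "T = {Inl a, Inr b}"
  using assms unfolding join_cells_def by blast

lemma join_cells_image:
  assumes "T \<in> join_cells A B" "f ` A \<subseteq> A'" "g ` B \<subseteq> B'"
  shows "map_sum f g ` T \<in> join_cells A' B'"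
  using assms(1) by (cases rule: join_cells_cases) (use assms(2,3) in \<open>auto simp: join_cells_iff\<close>)

lemma link_cell_map:
  assumes f: "coloured_map \<Gamma>A \<Gamma>A' fA" "coloured_map \<Gamma>B \<Gamma>B' fB" and S: "link_cell n \<Gamma>A \<Gamma>B S"
  shows "link_cell n \<Gamma>A' \<Gamma>B' (\<lambda>i. map_sum fA fB ` S i)"
  unfolding product_cell_def
proof (intro ballI conjI impI)
  fix i assume i: "i \<in> {1..n}"
  have "S i \<in> link_graph \<Gamma>A \<Gamma>B i" using S i by (simp add: product_cell_def)
  then show "map_sum fA fB ` S i \<in> link_graph \<Gamma>A' \<Gamma>B' i"
    by (rule join_cells_image) (auto intro: colour_class_coloured_map f)
next
  fix i j u' v' assume ij: "i \<in> {1..n}" "j \<in> {1..n}" "j \<noteq> i"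
    and u: "u' \<in> map_sum fA fB ` S i" and v: "v' \<in> map_sum fA fB ` S j"
  obtain u v where uv: "u \<in> S i" "u' = map_sum fA fB u" "v \<in> S j" "v' = map_sum fA fB v"
    using u v by blast
  have "compatible (simplices \<Gamma>A) (simplices \<Gamma>B) u v"
    using S ij uv by (simp add: product_cell_def)
  then show "compatible (simplices \<Gamma>A') (simplices \<Gamma>B') u' v'"
    unfolding uv using edge_coloured_map[OF f(1)] edge_coloured_map[OF f(2)]
    by (cases u; cases v) simp_all
qed

lemma closed_cube_push_point:
  assumes E: "\<And>i. i \<in> {1..n} \<Longrightarrow> finite (E i)" and p: "p \<in> closed_cube n E"
  shows "push_point n f p \<in> closed_cube n (\<lambda>i\<in>{1..n}. f i ` E i)"
proof (rule iffD2[OF closed_cube_iff])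
  show "finite ((\<lambda>i\<in>{1..n}. f i ` E i) i)" if "i \<in> {1..n}" for i using that E by simp
  have *: "weight (p i) \<and> support (p i) \<subseteq> E i" if "i \<in> {1..n}" for i
    using iffD1[OF closed_cube_iff[OF E] p] that by blast
  show "push_point n f p \<in> extensional {1..n} \<and> (\<forall>i\<in>{1..n}. weight (push_point n f p i) \<and>
      support (push_point n f p i) \<subseteq> (\<lambda>i\<in>{1..n}. f i ` E i) i)"
  proof (intro conjI ballI)
    show "push_point n f p \<in> extensional {1..n}" by (simp add: push_point_def)
    fix i assume i: "i \<in> {1..n}"
    then show "weight (push_point n f p i)" using * by (simp add: push_point_def weight_push_forward)
    show "support (push_point n f p i) \<subseteq> (\<lambda>i\<in>{1..n}. f i ` E i) i"
      using *[OF i] i by (simp add: support_push_point image_mono)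
  qed
qed

lemma closed_cube_points:
  assumes "\<And>i. i \<in> {1..n} \<Longrightarrow> finite (E i)" "p \<in> closed_cube n E"
  shows "p \<in> points n (\<lambda>_. True)"
  using iffD1[OF closed_cube_iff[OF assms(1)] assms(2)] by (simp add: points_def)

lemma finite_join_cell: "T \<in> join_cells A B \<Longrightarrow> finite T"
  by (auto simp: join_cells_def)

lemma inj_on_join_cell: "T \<in> join_cells A B \<Longrightarrow> inj_on (map_sum f g) T"
  by (auto simp: join_cells_def inj_on_def)

text \<open>The two ends of an edge lie on different sides, and sides are preserved, so no edge is
  collapsed. Every cube is mapped onto a cube of the same dimension with unchanged coordinates: the
  projection has \<open>j\<close> the identity and \<open>R\<close> empty.\<close>

lemma cubical_map_coupled_map:
  assumes A: "is_coloured n \<Gamma>A" "flag_complex (simplices \<Gamma>A)"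
    and A': "is_coloured n \<Gamma>A'" "flag_complex (simplices \<Gamma>A')"
    and B: "is_coloured n \<Gamma>B" "flag_complex (simplices \<Gamma>B)"
    and B': "is_coloured n \<Gamma>B'" "flag_complex (simplices \<Gamma>B')"
    and f: "coloured_map \<Gamma>A \<Gamma>A' fA" "coloured_map \<Gamma>B \<Gamma>B' fB"
  shows "cubical_map n (coupled_link_complex n \<Gamma>A \<Gamma>B) (coupled_link_complex n \<Gamma>A' \<Gamma>B')
    (coupled_map n fA fB)"
  unfolding cubical_map_def
proof
  interpret X': graph_product n "link_graph \<Gamma>A' \<Gamma>B'" "compatible (simplices \<Gamma>A') (simplices \<Gamma>B')"
    by (rule graph_product_link[OF A'(1) B'(1)])
  let ?f = "map_sum fA fB" and ?F = "coupled_map n fA fB"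
  fix E assume "E \<in> coupled_link_complex n \<Gamma>A \<Gamma>B"
  then have E: "link_cell n \<Gamma>A \<Gamma>B E" by (simp add: coupled_link_complex_eq[OF A B])
  then have Ei: "E i \<in> link_graph \<Gamma>A \<Gamma>B i" if "i \<in> {1..n}" for i
    using that by (simp add: product_cell_def)
  have fin: "finite (E i)" if "i \<in> {1..n}" for i using Ei[OF that] by (rule finite_join_cell)
  define E' where "E' = (\<lambda>i\<in>{1..n}. ?f ` E i)"
  have fin': "finite (E' i)" if "i \<in> {1..n}" for i using fin that by (simp add: E'_def)
  have inj: "inj_on ?f (E i)" if "i \<in> {1..n}" for i using Ei[OF that] by (rule inj_on_join_cell)
  have "link_cell n \<Gamma>A' \<Gamma>B' E' = link_cell n \<Gamma>A' \<Gamma>B' (\<lambda>i. ?f ` E i)"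
    by (rule X'.local_family_pcell[unfolded local_family_def, rule_format]) (simp add: E'_def)
  then have "E' \<in> coupled_link_complex n \<Gamma>A' \<Gamma>B'"
    using link_cell_map[OF f E] by (simp add: coupled_link_complex_eq[OF A' B'] E'_def)
  moreover have "?F ` closed_cube n E = closed_cube n E'"
  proof (intro equalityI subsetI)
    fix q assume "q \<in> ?F ` closed_cube n E"
    then show "q \<in> closed_cube n E'"
      using closed_cube_push_point[of n E _ "\<lambda>_. ?f"] fin by (auto simp: coupled_map_eq E'_def)
  next
    fix q assume q: "q \<in> closed_cube n E'"
    have q': "q \<in> points n (\<lambda>_. True)" by (rule closed_cube_points[OF fin' q])
    \<comment> \<open>The vertex map is injective on every factor of the cube, so factorwise
      inverses supply a preimage of \<open>q\<close>.\<close>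
    define g where "g = (\<lambda>i. inv_into (E i) ?f)"
    have sub: "support (q i) \<subseteq> ?f ` E i" if "i \<in> {1..n}" for i
      using iffD1[OF closed_cube_iff[OF fin'] q] that by (simp add: E'_def)
    have "(\<lambda>i\<in>{1..n}. g i ` E' i) i = E i" if "i \<in> {1..n}" for i
      using that inj by (simp add: g_def E'_def inv_into_image_cancel)
    then have "closed_cube n (\<lambda>i\<in>{1..n}. g i ` E' i) = closed_cube n E"
      unfolding closed_cube_def by (intro PiE_cong) simp
    then have "push_point n g q \<in> closed_cube n E"
      using closed_cube_push_point[OF fin' q, of g] by simp
    moreover have "?F (push_point n g q) = q"
      unfolding coupled_map_eq push_point_push_point[OF q']
    proof (rule push_point_ident[OF q'])
      fix i v assume "i \<in> {1..n}" "v \<in> support (q i)"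
      then have "v \<in> ?f ` E i" using sub by (meson subsetD)
      then show "(?f \<circ> g i) v = v" by (simp add: g_def f_inv_into_f)
    qed
    ultimately show "q \<in> ?F ` closed_cube n E" by (metis image_eqI)
  qed
  moreover have "directions n E' = directions n E"
    unfolding directions_def using inj by (auto simp: E'_def card_image)
  moreover have "coord (?F p) i = coord p i" if "p \<in> closed_cube n E" "i \<in> directions n E" for p i
    unfolding coupled_map_eq
  proof (rule coord_push_point_eq)
    show i: "i \<in> {1..n}" using that(2) by (simp add: directions_def)
    show "weight (p i)" using iffD1[OF closed_cube_iff[OF fin] that(1)] i by blast
  qed simp
  ultimately show "\<exists>E'\<in>coupled_link_complex n \<Gamma>A' \<Gamma>B'. ?F ` closed_cube n E = closed_cube n E' \<and>
      (\<exists>j R. inj_on j (directions n E') \<and> j ` directions n E' \<subseteq> directions n E \<and>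
        (\<forall>p\<in>closed_cube n E. \<forall>i\<in>directions n E'.
          coord (?F p) i = (if i \<in> R then 1 - coord p (j i) else coord p (j i))))"
    by (intro bexI[of _ E'] conjI exI[of _ "\<lambda>i. i"] exI[of _ "{}"]) simp_all
qed

lemma link_vertices_coupled_map:
  assumes f: "coloured_map \<Gamma>A \<Gamma>A' fA" "coloured_map \<Gamma>B \<Gamma>B' fB"
    and x: "x \<in> link_vertices n \<Gamma>A \<Gamma>B"
  shows "\<exists>y\<in>link_vertices n \<Gamma>A' \<Gamma>B'. A_part n y = fA ` A_part n x \<and> B_part n y = fB ` B_part n x
    \<and> coupled_map n fA fB (vertex_point n x) = vertex_point n y"
proof -
  define y where "y = (\<lambda>i\<in>{1..n}. map_sum fA fB (x i))"
  have xi: "x i \<in> Inl ` colour_class \<Gamma>A i \<union> Inr ` colour_class \<Gamma>B i" if "i \<in> {1..n}" for i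
    using x that unfolding link_vertices_def ambient_vertices_def by blast
  have y: "y \<in> ambient_vertices n \<Gamma>A' \<Gamma>B'"
    unfolding ambient_vertices_def
  proof (rule PiE_I)
    fix i assume "i \<in> {1..n}"
    then show "y i \<in> Inl ` colour_class \<Gamma>A' i \<union> Inr ` colour_class \<Gamma>B' i"
      using xi[of i] colour_class_coloured_map[OF f(1)] colour_class_coloured_map[OF f(2)]
      by (auto simp: y_def)
  qed (auto simp: y_def)
  have map_sum_Inl: "map_sum fA fB w = Inl c \<longleftrightarrow> (\<exists>a. w = Inl a \<and> c = fA a)" for w c by (cases w) auto
  have map_sum_Inr: "map_sum fA fB w = Inr d \<longleftrightarrow> (\<exists>b. w = Inr b \<and> d = fB b)" for w d by (cases w) auto
  have parts: "A_part n y = fA ` A_part n x" "B_part n y = fB ` B_part n x"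
    unfolding A_part_def B_part_def y_def by (auto simp: map_sum_Inl map_sum_Inr)
  have "fA ` A_part n x \<in> simplices \<Gamma>A'" "fB ` B_part n x \<in> simplices \<Gamma>B'"
    using x f by (auto simp: link_vertices_def coloured_map_def simplicial_map_def)
  then have "y \<in> link_vertices n \<Gamma>A' \<Gamma>B'" using y parts by (simp add: link_vertices_def)
  moreover have "coupled_map n fA fB (vertex_point n x) = vertex_point n y"
    unfolding coupled_map_def vertex_point_def
  proof (rule restrict_ext)
    fix i assume i: "i \<in> {1..n}"
    have "{v. (if v = x i then 1 else 0 :: real) \<noteq> 0 \<and> map_sum fA fB v = w} =
        (if w = y i then {x i} else {})" for w
      using i by (auto simp: y_def)
    then show "push_forward (map_sum fA fB) ((\<lambda>i\<in>{1..n}. \<lambda>v. if v = x i then 1 else 0) i) =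
        (\<lambda>v. if v = y i then 1 else 0)"
      using i by (simp add: push_forward_def fun_eq_iff)
  qed
  ultimately show ?thesis using parts by blast
qed

section \<open>Strings\<close>

text \<open>The hypotheses on \<open>g\<close> concern break points of the given string only,
  because the retraction used later is well behaved only near a base point.\<close>

lemma map_strings:
  assumes ps: "ps \<in> strings n C x y"
    and g: "\<And>p. p \<in> set ps \<Longrightarrow> g p \<in> realization n C'"
    and cube: "\<And>p q E. p \<in> set ps \<Longrightarrow> q \<in> set ps \<Longrightarrow> E \<in> C \<Longrightarrow> p \<in> closed_cube n E \<Longrightarrow> q \<in> closed_cube n E
      \<Longrightarrow> \<exists>E'\<in>C'. g p \<in> closed_cube n E' \<and> g q \<in> closed_cube n E'"
    and dist: "\<And>p q E. p \<in> set ps \<Longrightarrow> q \<in> set ps \<Longrightarrow> E \<in> C \<Longrightarrow> p \<in> closed_cube n E \<Longrightarrow> q \<in> closed_cube n E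
      \<Longrightarrow> cube_dist n (g p) (g q) \<le> cube_dist n p q"
  shows "map g ps \<in> strings n C' (g x) (g y) \<and> string_length n (map g ps) \<le> string_length n ps"
proof
  have succ: "\<exists>E\<in>C. ps ! k \<in> closed_cube n E \<and> ps ! Suc k \<in> closed_cube n E" if "Suc k < length ps" for k
    using ps that by (simp add: strings_def successively_conv_nth)
  show "map g ps \<in> strings n C' (g x) (g y)"
    unfolding strings_def
  proof (intro CollectI conjI)
    show "map g ps \<noteq> []" "hd (map g ps) = g x" "last (map g ps) = g y"
      using ps by (auto simp: strings_def hd_map last_map)
    show "set (map g ps) \<subseteq> realization n C'" using g by auto
    show "successively (\<lambda>p q. \<exists>E\<in>C'. p \<in> closed_cube n E \<and> q \<in> closed_cube n E) (map g ps)"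
      unfolding successively_conv_nth
    proof (intro allI impI)
      fix k assume k: "Suc k < length (map g ps)"
      then obtain E where "E \<in> C" "ps ! k \<in> closed_cube n E" "ps ! Suc k \<in> closed_cube n E"
        using succ[of k] by auto
      then show "\<exists>E\<in>C'. map g ps ! k \<in> closed_cube n E \<and> map g ps ! Suc k \<in> closed_cube n E"
        using cube[of "ps ! k" "ps ! Suc k" E] k by simp
    qed
  qed
  show "string_length n (map g ps) \<le> string_length n ps"
    unfolding string_length_def length_map
  proof (rule sum_mono)
    fix k assume "k \<in> {..<length ps - 1}"
    then have k: "Suc k < length ps" by auto
    then obtain E where "E \<in> C" "ps ! k \<in> closed_cube n E" "ps ! Suc k \<in> closed_cube n E"
      using succ[of k] by auto
    then show "cube_dist n (map g ps ! k) (map g ps ! Suc k) \<le> cube_dist n (ps ! k) (ps ! Suc k)"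
      using dist[of "ps ! k" "ps ! Suc k" E] k by simp
  qed
qed

lemma cube_dist_nonneg: "0 \<le> cube_dist n p q"
  by (simp add: cube_dist_def L2_set_nonneg)

lemma abs_coord_diff_le_cube_dist:
  assumes "i \<in> {1..n}"
  shows "\<bar>coord p i - coord q i\<bar> \<le> cube_dist n p q"
proof -
  have "\<bar>coord p i - coord q i\<bar> = L2_set (\<lambda>i. coord p i - coord q i) {i}" by (simp add: L2_set_def)
  also have "\<dots> \<le> cube_dist n p q"
    unfolding cube_dist_def L2_set_def using assms
    by (intro real_sqrt_le_mono sum_mono2) auto
  finally show ?thesis .
qed

lemma cube_dist_mono:
  assumes "\<And>i. i \<in> {1..n} \<Longrightarrow> \<bar>coord p i - coord q i\<bar> \<le> \<bar>coord p' i - coord q' i\<bar>"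
  shows "cube_dist n p q \<le> cube_dist n p' q'"
  unfolding cube_dist_def L2_set_def
  using assms by (intro real_sqrt_le_mono sum_mono) (simp add: abs_le_square_iff)

text \<open>The two weights on an edge add up to 1, so they change by the same amount; on a single
  vertex both sides vanish. Thus any vertex of the cell may be used to measure the
  coordinate.\<close>

lemma abs_coord_diff_eq:
  fixes p q :: "('a, 'b) point"
  assumes T: "T \<in> join_cells A B" and p: "weight (p i)" "support (p i) \<subseteq> T"
    and q: "weight (q i)" "support (q i) \<subseteq> T" and v: "v \<in> T"
  shows "\<bar>coord p i - coord q i\<bar> = \<bar>p i v - q i v\<bar>"
proof -
  have fin: "finite T" using T by (rule finite_join_cell)
  have c: "coord r i = (\<Sum>w\<in>T. r i w * side w)" "(\<Sum>w\<in>T. r i w) = 1"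
    if "weight (r i)" "support (r i) \<subseteq> T" for r :: "('a, 'b) point"
    using coord_eq[of r i, OF that(1)] sum_over_support[OF fin that(2), of side] weight_sum[OF that(1) fin that(2)]
    by simp_all
  show ?thesis using T
  proof (cases rule: join_cells_cases)
    case (1 a)
    then show ?thesis using c[of p, OF p] c[of q, OF q] v by simp
  next
    case (2 b)
    then show ?thesis using c[of p, OF p] c[of q, OF q] v by simp
  next
    case (3 a b)
    then have "coord p i = p i (Inr b)" "coord q i = q i (Inr b)"
      "p i (Inl a) = 1 - p i (Inr b)" "q i (Inl a) = 1 - q i (Inr b)"
      using c[of p, OF p] c[of q, OF q] by simp_all
    then show ?thesis using v 3 by auto
  qed
qed

text \<open>Weights are 1-Lipschitz along strings, also where a string passes from one cube to
  another. This is what keeps short strings inside a star.\<close>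

lemma abs_weight_diff_le_string_length:
  assumes C: "\<And>E i. E \<in> C \<Longrightarrow> i \<in> {1..n} \<Longrightarrow> E i \<in> join_cells (A i) (B i)"
    and ps: "ps \<in> strings n C x y" and p: "p \<in> set ps" and i: "i \<in> {1..n}"
  shows "\<bar>p i v - x i v\<bar> \<le> string_length n ps"
proof -
  have "\<bar>(ps ! k) i v - (ps ! 0) i v\<bar> \<le> (\<Sum>m<k. cube_dist n (ps ! m) (ps ! Suc m))" if "k < length ps" for k
    using that
  proof (induction k)
    case (Suc k)
    then obtain E where E: "E \<in> C" "ps ! k \<in> closed_cube n E" "ps ! Suc k \<in> closed_cube n E"
      using ps by (auto simp: strings_def successively_conv_nth)
    have fin: "finite (E j)" if "j \<in> {1..n}" for j using C[OF E(1) that] by (rule finite_join_cell)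
    have w: "weight ((ps ! k) i)" "support ((ps ! k) i) \<subseteq> E i"
      "weight ((ps ! Suc k) i)" "support ((ps ! Suc k) i) \<subseteq> E i"
      using iffD1[OF closed_cube_iff[OF fin] E(2)] iffD1[OF closed_cube_iff[OF fin] E(3)] i by blast+
    have "\<bar>(ps ! Suc k) i v - (ps ! k) i v\<bar> \<le> cube_dist n (ps ! k) (ps ! Suc k)"
    proof (cases "v \<in> E i")
      case True
      then have "\<bar>(ps ! k) i v - (ps ! Suc k) i v\<bar> \<le> cube_dist n (ps ! k) (ps ! Suc k)"
        using abs_coord_diff_eq[of _ _ _ "ps ! k" i "ps ! Suc k", OF C[OF E(1) i] w True] abs_coord_diff_le_cube_dist[OF i] by metis
      then show ?thesis by (simp add: abs_minus_commute)
    next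
      case False
      then have "(ps ! k) i v = 0" "(ps ! Suc k) i v = 0" using w by (auto simp: support_def)
      then show ?thesis by (simp add: cube_dist_nonneg)
    qed
    then show ?case using Suc by simp
  qed simp
  moreover obtain k where k: "k < length ps" "p = ps ! k" using p by (auto simp: in_set_conv_nth)
  moreover have "x = ps ! 0" using ps by (auto simp: strings_def hd_conv_nth)
  moreover have "(\<Sum>m<k. cube_dist n (ps ! m) (ps ! Suc m)) \<le> string_length n ps"
    unfolding string_length_def using k(1) by (intro sum_mono2) (auto simp: cube_dist_nonneg)
  ultimately show ?thesis by (meson order_trans)
qed

section \<open>Full inclusions\<close>

lemma join_cells_memD:
  assumes "T \<in> join_cells A B"
  shows "Inl a \<in> T \<Longrightarrow> a \<in> A" "Inr b \<in> T \<Longrightarrow> b \<in> B"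
  using assms by (auto elim!: join_cells_cases)

text \<open>Both ends of the edge are vertices of the image complex, so fullness puts the edge into
  the image, and injectivity on vertices identifies its preimage.\<close>

lemma full_inclusion_edge:
  assumes K: "simplicial_complex K" and f: "full_inclusion K L f"
    and u: "u \<in> vertices K" and v: "v \<in> vertices K" and edge: "{f u, f v} \<in> L"
  shows "{u, v} \<in> K"
proof -
  have "f ` {u} \<in> (`) f ` K" "f ` {v} \<in> (`) f ` K"
    using u v by (auto simp: vertices_def intro: imageI)
  then have "{f u, f v} \<subseteq> vertices ((`) f ` K)" by (simp add: vertices_def)
  then have "{f u, f v} \<in> (`) f ` K"
    using f edge by (simp add: full_inclusion_def full_subcomplex_def)
  then obtain \<sigma> where \<sigma>: "\<sigma> \<in> K" "{f u, f v} = f ` \<sigma>" by blast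
  have "\<sigma> \<subseteq> vertices K" using \<sigma>(1) simplex_subset[OF K] by (auto simp: vertices_def)
  moreover have "inj_on f (vertices K)" using f by (simp add: full_inclusion_def)
  ultimately have "{u, v} = \<sigma>"
    using u v \<sigma>(2) inj_on_image_eq_iff[of f "vertices K" "{u, v}" \<sigma>] by simp
  then show ?thesis using \<sigma>(1) by simp
qed

lemma colour_class_inv_into:
  assumes "coloured_map \<Gamma> \<Gamma>' f" "full_inclusion (simplices \<Gamma>) (simplices \<Gamma>') f"
    and v: "v \<in> vertices (simplices \<Gamma>)" "f v \<in> colour_class \<Gamma>' i"
  shows "inv_into (vertices (simplices \<Gamma>)) f (f v) \<in> colour_class \<Gamma> i"
proof -
  have "inv_into (vertices (simplices \<Gamma>)) f (f v) = v"
    using assms(2) v(1) unfolding full_inclusion_def by (intro inv_into_f_f) auto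
  moreover have "colour \<Gamma>' (f v) = colour \<Gamma> v"
    using assms(1) v(1) unfolding coloured_map_def by blast
  ultimately show ?thesis using v by (simp add: colour_class_def)
qed

locale link_inclusion =
  fixes n :: nat
    and \<Gamma>A :: "'a coloured_complex" and \<Gamma>A' :: "'c coloured_complex"
    and \<Gamma>B :: "'b coloured_complex" and \<Gamma>B' :: "'d coloured_complex"
    and fA :: "'a \<Rightarrow> 'c" and fB :: "'b \<Rightarrow> 'd"
  assumes A: "is_coloured n \<Gamma>A" "flag_complex (simplices \<Gamma>A)"
    and A': "is_coloured n \<Gamma>A'" "flag_complex (simplices \<Gamma>A')"
    and B: "is_coloured n \<Gamma>B" "flag_complex (simplices \<Gamma>B)"
    and B': "is_coloured n \<Gamma>B'" "flag_complex (simplices \<Gamma>B')"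
    and coloured_f: "coloured_map \<Gamma>A \<Gamma>A' fA" "coloured_map \<Gamma>B \<Gamma>B' fB"
    and full_f: "full_inclusion (simplices \<Gamma>A) (simplices \<Gamma>A') fA"
      "full_inclusion (simplices \<Gamma>B) (simplices \<Gamma>B') fB"
begin

sublocale source: graph_product n "link_graph \<Gamma>A \<Gamma>B" "compatible (simplices \<Gamma>A) (simplices \<Gamma>B)"
  by (rule graph_product_link[OF A(1) B(1)])

sublocale target: graph_product n "link_graph \<Gamma>A' \<Gamma>B'" "compatible (simplices \<Gamma>A') (simplices \<Gamma>B')"
  by (rule graph_product_link[OF A'(1) B'(1)])

abbreviation "f \<equiv> map_sum fA fB"

definition "W = Inl ` vertices (simplices \<Gamma>A) \<union> Inr ` vertices (simplices \<Gamma>B)"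

definition "V = f ` W"

text \<open>Outside \<open>V\<close> the values are arbitrary, but the side of a vertex is preserved
  everywhere.\<close>

definition "f_inv = map_sum (inv_into (vertices (simplices \<Gamma>A)) fA) (inv_into (vertices (simplices \<Gamma>B)) fB)"

lemma f_inv_f: "u \<in> W \<Longrightarrow> f_inv (f u) = u"
  using full_f by (auto simp: W_def f_inv_def full_inclusion_def)

lemma f_f_inv: "w \<in> V \<Longrightarrow> f (f_inv w) = w"
  by (auto simp: V_def f_inv_f)

lemma f_inv_in_W: "w \<in> V \<Longrightarrow> f_inv w \<in> W"
  by (auto simp: V_def f_inv_f)

lemma side_f_inv: "side (f_inv w) = side w"
  by (simp add: f_inv_def)

lemma f_in_V: "u \<in> W \<Longrightarrow> f u \<in> V"
  by (simp add: V_def)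

lemma cell_in_W: "link_cell n \<Gamma>A \<Gamma>B S \<Longrightarrow> i \<in> {1..n} \<Longrightarrow> u \<in> S i \<Longrightarrow> u \<in> W"
  unfolding product_cell_def W_def join_cells_def colour_class_def by fastforce

lemma link_cell_f: "link_cell n \<Gamma>A \<Gamma>B S \<Longrightarrow> link_cell n \<Gamma>A' \<Gamma>B' (\<lambda>i. f ` S i)"
  by (rule link_cell_map[OF coloured_f])

text \<open>Here fullness, as opposed to mere injectivity, enters the proof.\<close>

lemma compatible_f:
  assumes "u \<in> W" "v \<in> W" "compatible (simplices \<Gamma>A') (simplices \<Gamma>B') (f u) (f v)"
  shows "compatible (simplices \<Gamma>A) (simplices \<Gamma>B) u v"
  using assms full_inclusion_edge[OF is_coloured_simplicial[OF A(1)] full_f(1)]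
    full_inclusion_edge[OF is_coloured_simplicial[OF B(1)] full_f(2)]
  by (cases u; cases v) (auto simp: W_def)

text \<open>Fullness passes from the simplicial complexes to the cube complexes: the image of the
  source contains every target cube with all vertices in \<open>V\<close>.\<close>

lemma link_cell_f_inv:
  assumes S: "link_cell n \<Gamma>A' \<Gamma>B' S" and V: "\<And>i. i \<in> {1..n} \<Longrightarrow> S i \<subseteq> V"
  shows "link_cell n \<Gamma>A \<Gamma>B (\<lambda>i. f_inv ` S i)"
  unfolding product_cell_def
proof (intro ballI conjI impI)
  fix i assume i: "i \<in> {1..n}"
  have Si: "S i \<in> link_graph \<Gamma>A' \<Gamma>B' i" using S i by (simp add: product_cell_def)
  have cA: "inv_into (vertices (simplices \<Gamma>A)) fA c \<in> colour_class \<Gamma>A i"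
    if "Inl c \<in> S i" for c
  proof -
    have "Inl c \<in> V" using V[OF i] that by (rule subsetD)
    then obtain a where a: "a \<in> vertices (simplices \<Gamma>A)" "c = fA a" by (auto simp: V_def W_def)
    moreover have "c \<in> colour_class \<Gamma>A' i" by (rule join_cells_memD(1)[OF Si that])
    ultimately show ?thesis using colour_class_inv_into[OF coloured_f(1) full_f(1)] by simp
  qed
  have cB: "inv_into (vertices (simplices \<Gamma>B)) fB d \<in> colour_class \<Gamma>B i"
    if "Inr d \<in> S i" for d
  proof -
    have "Inr d \<in> V" using V[OF i] that by (rule subsetD)
    then obtain b where b: "b \<in> vertices (simplices \<Gamma>B)" "d = fB b" by (auto simp: V_def W_def)
    moreover have "d \<in> colour_class \<Gamma>B' i" by (rule join_cells_memD(2)[OF Si that])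
    ultimately show ?thesis using colour_class_inv_into[OF coloured_f(2) full_f(2)] by simp
  qed
  show "f_inv ` S i \<in> link_graph \<Gamma>A \<Gamma>B i"
    using Si cA cB by (cases rule: join_cells_cases) (auto simp: f_inv_def join_cells_iff)
next
  fix i j u' v' assume ij: "i \<in> {1..n}" "j \<in> {1..n}" "j \<noteq> i"
    and u: "u' \<in> f_inv ` S i" and v: "v' \<in> f_inv ` S j"
  obtain u v where uv: "u \<in> S i" "u' = f_inv u" "v \<in> S j" "v' = f_inv v"
    using u v by blast
  have "u \<in> V" "v \<in> V" using V ij uv by (meson subsetD)+
  moreover have "compatible (simplices \<Gamma>A') (simplices \<Gamma>B') u v"
    using S ij uv by (simp add: product_cell_def)
  ultimately show "compatible (simplices \<Gamma>A) (simplices \<Gamma>B) u' v'"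
    unfolding uv by (intro compatible_f f_inv_in_W) (simp_all add: f_f_inv)
qed

abbreviation "X \<equiv> points n (link_cell n \<Gamma>A \<Gamma>B)"
abbreviation "X' \<equiv> points n (link_cell n \<Gamma>A' \<Gamma>B')"
abbreviation "F \<equiv> push_point n (\<lambda>_. f)"

lemma support_in_W: "x \<in> X \<Longrightarrow> i \<in> {1..n} \<Longrightarrow> u \<in> support (x i) \<Longrightarrow> u \<in> W"
  by (rule cell_in_W[OF supports_points[of x]])

lemma F_in_X':
  assumes x: "x \<in> X"
  shows "F x \<in> X'"
  using push_point_in_points[OF x target.local_family_pcell] link_cell_f[OF supports_points[OF x]]
  by simp

lemma source_cube: "E \<in> coupled_link_complex n \<Gamma>A \<Gamma>B \<longleftrightarrow> E \<in> extensional {1..n} \<and> link_cell n \<Gamma>A \<Gamma>B E"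
  by (simp add: coupled_link_complex_eq[OF A B])

lemma target_cube: "E \<in> coupled_link_complex n \<Gamma>A' \<Gamma>B' \<longleftrightarrow> E \<in> extensional {1..n} \<and> link_cell n \<Gamma>A' \<Gamma>B' E"
  by (simp add: coupled_link_complex_eq[OF A' B'])

end

section \<open>Local isometry\<close>

context link_inclusion
begin

text \<open>Near \<open>F x\<close>, zeroing the coordinates outside \<open>V\<close> is a 1-Lipschitz retraction onto \<open>F ` X\<close>: a factor
  of a cube around \<open>F x\<close> that is not contained in \<open>V\<close> is collapsed to the vertex of \<open>F x\<close> in it.\<close>

definition retract :: "('a, 'b) point \<Rightarrow> nat \<Rightarrow> 'c + 'd \<Rightarrow> 'a + 'b" where
  "retract x i w = (if w \<in> V then f_inv w else SOME v. v \<in> support (x i))"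

text \<open>The open star of the carrier of \<open>F x\<close>. Every factor of a cube through such
  a point meets \<open>V\<close>, which is what \<open>retract\<close> relies on.\<close>

definition star :: "('a, 'b) point \<Rightarrow> ('c, 'd) point set" where
  "star x = {p. \<forall>i\<in>{1..n}. f ` support (x i) \<subseteq> support (p i)}"

lemma retract_f: "u \<in> W \<Longrightarrow> retract x i (f u) = u"
  by (simp add: retract_def f_in_V f_inv_f)

text \<open>Every factor of the cell meets \<open>V\<close>, so discarding the vertices outside
  \<open>V\<close> leaves a face. The default value of \<open>retract\<close> is already a vertex of
  that face and adds nothing to the image.\<close>

lemma retract_cell:
  assumes x: "x \<in> X" and S: "link_cell n \<Gamma>A' \<Gamma>B' S"
    and sub: "\<And>i. i \<in> {1..n} \<Longrightarrow> f ` support (x i) \<subseteq> S i"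
  shows "link_cell n \<Gamma>A \<Gamma>B (\<lambda>i. retract x i ` S i)"
proof -
  have base: "f v \<in> S i \<inter> V" "f_inv (f v) = v" if "i \<in> {1..n}" "v \<in> support (x i)" for i v
    using sub[OF that(1)] that support_in_W[OF x that] f_in_V f_inv_f by auto
  have ne: "support (x i) \<noteq> {}" if "i \<in> {1..n}" for i
    using support_nonempty[OF weight_points[OF x that]] .
  have "retract x i ` S i = f_inv ` (S i \<inter> V)" if i: "i \<in> {1..n}" for i
  proof (intro equalityI subsetI)
    fix u assume "u \<in> retract x i ` S i"
    then obtain w where w: "w \<in> S i" "u = retract x i w" by blast
    show "u \<in> f_inv ` (S i \<inter> V)"
    proof (cases "w \<in> V")
      case True
      then show ?thesis using w by (simp add: retract_def)
    next
      case False
      then have "u \<in> support (x i)" using w ne[OF i] by (simp add: retract_def some_in_eq)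
      then show ?thesis using base[OF i] by (metis image_eqI)
    qed
  next
    fix u assume "u \<in> f_inv ` (S i \<inter> V)"
    then show "u \<in> retract x i ` S i" by (force simp: retract_def)
  qed
  then have "link_cell n \<Gamma>A \<Gamma>B (\<lambda>i. retract x i ` S i) = link_cell n \<Gamma>A \<Gamma>B (\<lambda>i. f_inv ` (S i \<inter> V))"
    by (rule source.local_family_pcell[unfolded local_family_def, rule_format])
  moreover have "link_cell n \<Gamma>A' \<Gamma>B' (\<lambda>i. S i \<inter> V)"
  proof (rule target.pcell_subset[OF S])
    show "S i \<inter> V \<noteq> {}" if "i \<in> {1..n}" for i using base(1)[OF that] ne[OF that] by blast
  qed simp
  ultimately show ?thesis using link_cell_f_inv[of "\<lambda>i. S i \<inter> V"] by simp
qed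

lemma source_cell: "E \<in> coupled_link_complex n \<Gamma>A \<Gamma>B \<Longrightarrow> i \<in> {1..n} \<Longrightarrow> E i \<in> link_graph \<Gamma>A \<Gamma>B i"
  by (simp add: source_cube product_cell_def)

lemma target_cell: "E \<in> coupled_link_complex n \<Gamma>A' \<Gamma>B' \<Longrightarrow> i \<in> {1..n} \<Longrightarrow> E i \<in> link_graph \<Gamma>A' \<Gamma>B' i"
  by (simp add: target_cube product_cell_def)

lemma source_cubeD:
  assumes "E \<in> coupled_link_complex n \<Gamma>A \<Gamma>B" "p \<in> closed_cube n E" "i \<in> {1..n}"
  shows "weight (p i)" "support (p i) \<subseteq> E i"
  using closed_cube_iff[of n E p] finite_join_cell[OF source_cell[OF assms(1)]] assms(2,3) by simp_all

lemma target_cubeD: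
  assumes "E \<in> coupled_link_complex n \<Gamma>A' \<Gamma>B'" "p \<in> closed_cube n E" "i \<in> {1..n}"
  shows "weight (p i)" "support (p i) \<subseteq> E i"
  using closed_cube_iff[of n E p] finite_join_cell[OF target_cell[OF assms(1)]] assms(2,3) by simp_all

lemma retract_cube:
  assumes x: "x \<in> X" and E: "E \<in> coupled_link_complex n \<Gamma>A' \<Gamma>B'"
    and p: "p \<in> closed_cube n E" "p \<in> star x"
  shows "(\<lambda>i\<in>{1..n}. retract x i ` E i) \<in> coupled_link_complex n \<Gamma>A \<Gamma>B"
proof -
  have "f ` support (x i) \<subseteq> E i" if "i \<in> {1..n}" for i
    using target_cubeD(2)[OF E p(1) that] p(2) that unfolding star_def by blast
  then have "link_cell n \<Gamma>A \<Gamma>B (\<lambda>i. retract x i ` E i)"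
    using retract_cell[OF x] E by (simp add: target_cube)
  moreover have "link_cell n \<Gamma>A \<Gamma>B (\<lambda>i\<in>{1..n}. retract x i ` E i) = link_cell n \<Gamma>A \<Gamma>B (\<lambda>i. retract x i ` E i)"
    by (rule source.local_family_pcell[unfolded local_family_def, rule_format]) simp
  ultimately show ?thesis by (simp add: source_cube)
qed

lemma retract_in_cube:
  assumes E: "E \<in> coupled_link_complex n \<Gamma>A' \<Gamma>B'" and p: "p \<in> closed_cube n E"
  shows "push_point n (retract x) p \<in> closed_cube n (\<lambda>i\<in>{1..n}. retract x i ` E i)"
  by (rule closed_cube_push_point[OF _ p]) (rule finite_join_cell[OF target_cell[OF E]])

text \<open>In each factor the retraction either preserves the coordinate, when the cell lies in
  \<open>V\<close>, or makes it constant, when the cell is an edge with one end outside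
  \<open>V\<close>.\<close>

lemma retract_coord:
  assumes x: "x \<in> X" and E: "E \<in> coupled_link_complex n \<Gamma>A' \<Gamma>B'" and i: "i \<in> {1..n}"
    and p: "p \<in> closed_cube n E" "p \<in> star x" and q: "q \<in> closed_cube n E"
  shows "\<bar>coord (push_point n (retract x) p) i - coord (push_point n (retract x) q) i\<bar>
    \<le> \<bar>coord p i - coord q i\<bar>"
proof (cases "E i \<subseteq> V")
  case True
  have "coord (push_point n (retract x) r) i = coord r i" if "r \<in> closed_cube n E" for r
  proof (rule coord_push_point_eq[OF i])
    show "weight (r i)" using target_cubeD[OF E that i] by simp
    show "side (retract x i v) = side v" if "v \<in> support (r i)" for v
      using that True target_cubeD(2)[OF E \<open>r \<in> _\<close> i] by (simp add: retract_def side_f_inv subset_eq)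
  qed
  then show ?thesis using p q by simp
next
  case False
  then obtain w where w: "w \<in> E i" "w \<notin> V" by blast
  obtain v where v: "v \<in> support (x i)"
    using support_nonempty[OF weight_points[OF x i]] by blast
  have sub: "f ` support (x i) \<subseteq> E i"
    using target_cubeD(2)[OF E p(1) i] p(2) i unfolding star_def by blast
  have inV: "f u \<in> V" "f_inv (f u) = u" if "u \<in> support (x i)" for u
    using support_in_W[OF x i that] by (simp_all add: f_in_V f_inv_f)
  have "f v \<in> E i" using sub v by blast
  moreover have "w \<noteq> f v" using w inV(1)[OF v] by blast
  ultimately have Ei: "E i = {w, f v}" using join_cell_eq[OF target_cell[OF E i] w(1)] by blast
  \<comment> \<open>One end of the edge is outside \<open>V\<close>, so \<open>x\<close> sits at a
    vertex in this factor. The default value of \<open>retract\<close> is then the same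
    \<open>v\<close> to which the other end goes.\<close>
  have single: "u = v" if "u \<in> support (x i)" for u
  proof -
    have "f u \<in> {w, f v}" using sub that Ei by blast
    then have "f u = f v" using inV(1)[OF that] w by blast
    then show ?thesis using inV(2)[OF that] inV(2)[OF v] by metis
  qed
  then have "(SOME u. u \<in> support (x i)) = v" using v by (metis someI)
  then have ret: "retract x i u = v" if "u \<in> E i" for u
    using that w inV[OF v] unfolding Ei by (auto simp: retract_def)
  have "coord (push_point n (retract x) r) i = side v" if r: "r \<in> closed_cube n E" for r
  proof -
    have wr: "weight (r i)" "support (r i) \<subseteq> E i" using target_cubeD[OF E r i] by simp_all
    have "(\<Sum>u\<in>support (r i). r i u * side (retract x i u)) = (\<Sum>u\<in>support (r i). r i u * side v)"
      using ret wr(2) by (intro sum.cong) (auto simp: subset_eq)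
    also have "\<dots> = side v" using wr(1) by (simp add: sum_distrib_right[symmetric] weight_def)
    finally show ?thesis by (simp add: coord_push_point[of i n r, OF i wr(1)])
  qed
  then show ?thesis using p q by simp
qed

lemma retract_F:
  assumes "u \<in> X"
  shows "push_point n (retract x) (F u) = u"
  unfolding push_point_push_point[OF assms]
  by (rule push_point_ident[OF assms]) (simp add: retract_f support_in_W[OF assms])

lemma realizations:
  "realization n (coupled_link_complex n \<Gamma>A \<Gamma>B) = X"
  "realization n (coupled_link_complex n \<Gamma>A' \<Gamma>B') = X'"
  by (rule realization_link[OF A B], rule realization_link[OF A' B'])

text \<open>This inequality is global, since \<open>F\<close> preserves coordinates on every cube.
  Only the converse is local.\<close>

lemma path_dist_F_le:
  "path_dist n (coupled_link_complex n \<Gamma>A' \<Gamma>B') (F u) (F v) \<le> path_dist n (coupled_link_complex n \<Gamma>A \<Gamma>B) u v"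
  unfolding path_dist_def
proof (rule INF_mono)
  let ?C = "coupled_link_complex n \<Gamma>A \<Gamma>B" and ?C' = "coupled_link_complex n \<Gamma>A' \<Gamma>B'"
  fix ps assume ps: "ps \<in> strings n ?C u v"
  have coord: "coord (F p) i = coord p i" if "E \<in> ?C" "p \<in> closed_cube n E" "i \<in> {1..n}" for p i E
    by (rule coord_push_point_eq[of i n p, OF that(3) source_cubeD(1)[OF that]]) simp
  have "map F ps \<in> strings n ?C' (F u) (F v) \<and> string_length n (map F ps) \<le> string_length n ps"
  proof (rule map_strings[OF ps])
    show "F p \<in> realization n ?C'" if "p \<in> set ps" for p
      using that ps F_in_X' by (auto simp: strings_def realizations)
    show "\<exists>E'\<in>?C'. F p \<in> closed_cube n E' \<and> F q \<in> closed_cube n E'"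
      if "E \<in> ?C" "p \<in> closed_cube n E" "q \<in> closed_cube n E" for p q E
    proof (intro bexI conjI)
      have fin: "finite (E i)" if "i \<in> {1..n}" for i
        using finite_join_cell[OF source_cell[OF \<open>E \<in> ?C\<close> that]] .
      show "F p \<in> closed_cube n (\<lambda>i\<in>{1..n}. f ` E i)"
        by (rule closed_cube_push_point[OF fin that(2)])
      show "F q \<in> closed_cube n (\<lambda>i\<in>{1..n}. f ` E i)"
        by (rule closed_cube_push_point[OF fin that(3)])
      have "link_cell n \<Gamma>A' \<Gamma>B' (\<lambda>i\<in>{1..n}. f ` E i) = link_cell n \<Gamma>A' \<Gamma>B' (\<lambda>i. f ` E i)"
        by (rule target.local_family_pcell[unfolded local_family_def, rule_format]) simp
      then show "(\<lambda>i\<in>{1..n}. f ` E i) \<in> ?C'"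
        using link_cell_f[of E] \<open>E \<in> ?C\<close> by (simp add: source_cube target_cube)
    qed
    show "cube_dist n (F p) (F q) \<le> cube_dist n p q"
      if "E \<in> ?C" "p \<in> closed_cube n E" "q \<in> closed_cube n E" for p q E
      using coord[OF that(1,2)] coord[OF that(1,3)] by (intro cube_dist_mono) simp
  qed
  then show "\<exists>qs\<in>strings n ?C' (F u) (F v). ereal (string_length n qs) \<le> ereal (string_length n ps)"
    by (intro bexI[of _ "map F ps"]) simp_all
qed

lemma path_dist_le_string_in_star:
  assumes x: "x \<in> X" and uv: "u \<in> X" "v \<in> X"
    and ps: "ps \<in> strings n (coupled_link_complex n \<Gamma>A' \<Gamma>B') (F u) (F v)" "set ps \<subseteq> star x"
  shows "path_dist n (coupled_link_complex n \<Gamma>A \<Gamma>B) u v \<le> ereal (string_length n ps)"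
proof -
  let ?C = "coupled_link_complex n \<Gamma>A \<Gamma>B" and ?C' = "coupled_link_complex n \<Gamma>A' \<Gamma>B'"
  let ?R = "push_point n (retract x)"
  have cube: "\<exists>E'\<in>?C. ?R p \<in> closed_cube n E' \<and> ?R q \<in> closed_cube n E'"
    if "p \<in> set ps" "E \<in> ?C'" "p \<in> closed_cube n E" "q \<in> closed_cube n E" for p q E
  proof (intro bexI conjI)
    show "(\<lambda>i\<in>{1..n}. retract x i ` E i) \<in> ?C"
      using retract_cube[OF x that(2,3)] that(1) ps(2) by blast
  qed (rule retract_in_cube[OF that(2,3)], rule retract_in_cube[OF that(2,4)])
  have "map ?R ps \<in> strings n ?C (?R (F u)) (?R (F v)) \<and> string_length n (map ?R ps) \<le> string_length n ps"
  proof (rule map_strings[OF ps(1)])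
    show "?R p \<in> realization n ?C" if p: "p \<in> set ps" for p
    proof -
      have "p \<in> realization n ?C'" using ps(1) p by (auto simp: strings_def)
      then obtain E where "E \<in> ?C'" "p \<in> closed_cube n E" by (auto simp: realization_def)
      then show ?thesis using cube[OF p, of E p] by (auto simp: realization_def)
    qed
    show "cube_dist n (?R p) (?R q) \<le> cube_dist n p q"
      if "p \<in> set ps" "E \<in> ?C'" "p \<in> closed_cube n E" "q \<in> closed_cube n E" for p q E
      using retract_coord[OF x that(2) _ that(3) _ that(4)] that(1) ps(2)
      by (intro cube_dist_mono) blast
  qed (use cube in blast)
  then have qs: "map ?R ps \<in> strings n ?C u v" "string_length n (map ?R ps) \<le> string_length n ps"
    by (simp_all add: retract_F uv)
  have "path_dist n ?C u v \<le> ereal (string_length n (map ?R ps))"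
    unfolding path_dist_def by (rule INF_lower[OF qs(1)])
  also have "\<dots> \<le> ereal (string_length n ps)" using qs(2) by simp
  finally show ?thesis .
qed

text \<open>The hypothesis \<open>near\<close> bounds weights only from below. The weights of
  \<open>u\<close> and of \<open>x\<close> have the same total, so \<open>u i v \<le> x i v\<close>
  for some vertex \<open>v\<close> of \<open>x\<close>; there the bound is two-sided, and a single
  vertex measures the coordinate. The factor \<open>n\<close> comes from estimating the Euclidean
  norm by the sum of absolute values.\<close>

lemma cube_dist_base_le:
  fixes \<delta> :: real
  assumes x: "x \<in> X" and u: "u \<in> X" and \<delta>: "0 \<le> \<delta>"
    and sub: "\<And>i. i \<in> {1..n} \<Longrightarrow> support (x i) \<subseteq> support (u i)"
    and near: "\<And>i v. i \<in> {1..n} \<Longrightarrow> v \<in> support (x i) \<Longrightarrow> x i v - \<delta> < u i v"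
  shows "cube_dist n u x \<le> n * \<delta>"
proof -
  have "\<bar>coord u i - coord x i\<bar> \<le> \<delta>" if i: "i \<in> {1..n}" for i
  proof -
    have w: "weight (u i)" "weight (x i)" using weight_points u x i by blast+
    obtain v where v: "v \<in> support (x i)" "u i v \<le> x i v"
    proof (rule ccontr)
      assume "\<not> thesis"
      then have less: "x i v < u i v" if "v \<in> support (x i)" for v using that \<open>\<And>v. _ \<Longrightarrow> _ \<Longrightarrow> thesis\<close> by force
      have "sum (x i) (support (x i)) < sum (u i) (support (x i))"
        using less w(2) by (intro sum_strict_mono) (auto simp: finite_support support_nonempty)
      also have "\<dots> \<le> sum (u i) (support (u i))"
        using w(1) sub[OF i] by (intro sum_mono2) (auto simp: finite_support weight_nonneg)
      finally show False using w by (simp add: weight_def)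
    qed
    have "support (u i) \<in> link_graph \<Gamma>A \<Gamma>B i"
      using supports_points[OF u] i by (simp add: product_cell_def)
    moreover have "v \<in> support (u i)" using v(1) sub[OF i] by blast
    ultimately have "\<bar>coord u i - coord x i\<bar> = \<bar>u i v - x i v\<bar>"
      by (rule abs_coord_diff_eq[of _ _ _ u i x, OF _ w(1) order_refl w(2) sub[OF i]])
    then show ?thesis using v(2) near[OF i v(1)] by simp
  qed
  then have "(\<Sum>i\<in>{1..n}. \<bar>coord u i - coord x i\<bar>) \<le> (\<Sum>i\<in>{1..n}. \<delta>)" by (rule sum_mono)
  moreover have "cube_dist n u x \<le> (\<Sum>i\<in>{1..n}. \<bar>coord u i - coord x i\<bar>)"
    unfolding cube_dist_def by (rule L2_set_le_sum_abs)
  ultimately show ?thesis by simp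
qed

lemma path_dist_le_through_base:
  assumes x: "x \<in> X" and u: "u \<in> X" "\<And>i. i \<in> {1..n} \<Longrightarrow> support (x i) \<subseteq> support (u i)"
    and v: "v \<in> X" "\<And>i. i \<in> {1..n} \<Longrightarrow> support (x i) \<subseteq> support (v i)"
  shows "path_dist n (coupled_link_complex n \<Gamma>A \<Gamma>B) u v \<le> ereal (cube_dist n u x + cube_dist n x v)"
proof -
  let ?C = "coupled_link_complex n \<Gamma>A \<Gamma>B"
  have cube: "\<exists>E\<in>?C. w \<in> closed_cube n E \<and> x \<in> closed_cube n E"
    if w: "w \<in> X" "\<And>i. i \<in> {1..n} \<Longrightarrow> support (x i) \<subseteq> support (w i)" for w
  proof
    define E where "E = (\<lambda>i\<in>{1..n}. support (w i))"
    have "link_cell n \<Gamma>A \<Gamma>B E = link_cell n \<Gamma>A \<Gamma>B (\<lambda>i. support (w i))"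
      by (rule source.local_family_pcell[unfolded local_family_def, rule_format]) (simp add: E_def)
    then show "E \<in> ?C" using supports_points[OF w(1)] by (simp add: source_cube E_def)
    have "finite (E i)" if "i \<in> {1..n}" for i
      using finite_support[OF weight_points[OF w(1) that]] that by (simp add: E_def)
    then show "w \<in> closed_cube n E \<and> x \<in> closed_cube n E"
      using closed_cube_iff[of n E] w x by (simp add: E_def points_def)
  qed
  have "[u, x, v] \<in> strings n ?C u v"
    using cube[OF u] cube[OF v] u(1) v(1) x by (auto simp: strings_def realizations)
  then have "path_dist n ?C u v \<le> ereal (string_length n [u, x, v])"
    unfolding path_dist_def by (rule INF_lower)
  then show ?thesis by (simp add: string_length_def numeral_2_eq_2)
qed

text \<open>The number \<open>\<epsilon>\<close> is the least positive weight of \<open>x\<close>,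
  capped at 1. Points of \<open>U\<close> are within \<open>\<epsilon> / 4\<close> of
  \<open>x\<close>, so they are joined through \<open>x\<close> by a string of length at most
  \<open>\<epsilon> / 2\<close>, and only target strings shorter than that can matter. Such a string
  starts with weights above \<open>3 * \<epsilon> / 4\<close> on the vertices of \<open>F x\<close>,
  loses less than \<open>\<epsilon> / 2\<close>, and so stays in the star, where it can be
  retracted.\<close>

lemma local_isometry_F:
  "local_isometry n (coupled_link_complex n \<Gamma>A \<Gamma>B) (coupled_link_complex n \<Gamma>A' \<Gamma>B') F"
  unfolding local_isometry_def realizations
proof (intro conjI ballI)
  let ?C = "coupled_link_complex n \<Gamma>A \<Gamma>B" and ?C' = "coupled_link_complex n \<Gamma>A' \<Gamma>B'"
  show "F ` X \<subseteq> X'" using F_in_X' by blast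
  fix x assume x: "x \<in> X"
  \<comment> \<open>The entry 1 keeps \<open>M\<close> nonempty when \<open>n = 0\<close>.\<close>
  define M where "M = insert 1 (\<Union>i\<in>{1..n}. x i ` support (x i))"
  define \<epsilon> where "\<epsilon> = Min M"
  \<comment> \<open>The factor \<open>n + 1\<close> gives both
    \<open>n * \<delta> \<le> \<epsilon> / 4\<close> and
    \<open>\<delta> \<le> \<epsilon> / 4\<close>, and it is nonzero for
    \<open>n = 0\<close>.\<close>
  define \<delta> where "\<delta> = \<epsilon> / (4 * (n + 1))"
  have fin: "finite (support (x i))" if "i \<in> {1..n}" for i
    using finite_support[OF weight_points[OF x that]] .
  then have M: "finite M" "M \<noteq> {}" by (auto simp: M_def)
  have "0 < m" if "m \<in> M" for m
    using that weight_nonneg[OF weight_points[OF x]] by (force simp: M_def support_def order_less_le)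
  then have \<epsilon>: "0 < \<epsilon>" using M by (simp add: \<epsilon>_def)
  have \<epsilon>_le: "\<epsilon> \<le> x i v" if "i \<in> {1..n}" "v \<in> support (x i)" for i v
    unfolding \<epsilon>_def using M(1) that by (intro Min_le) (auto simp: M_def)
  have \<delta>: "0 < \<delta>" "n * \<delta> \<le> \<epsilon> / 4" "\<delta> \<le> \<epsilon> / 4" using \<epsilon> by (auto simp: \<delta>_def field_simps)
  define N where "N = (\<Inter>i\<in>{1..n}. \<Inter>v\<in>support (x i). {u :: ('a, 'b) point. x i v - \<delta> < u i v})"
  define U where "U = X \<inter> N"
  have "open N"
    unfolding N_def
    by (intro open_INT ballI fin open_Collect_less continuous_on_const continuous_on_coordinate) simp
  then have "openin (top_of_set X) U" unfolding U_def by (rule openin_open_Int)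
  moreover have "x \<in> U" using x \<delta>(1) by (simp add: U_def N_def)
  moreover have "path_dist n ?C' (F u) (F v) = path_dist n ?C u v" if uv: "u \<in> U" "v \<in> U" for u v
  proof (rule antisym[OF path_dist_F_le])
    have near: "x i a - \<delta> < w i a" if "w \<in> U" "i \<in> {1..n}" "a \<in> support (x i)" for w i a
      using that by (simp add: U_def N_def)
    have sub: "support (x i) \<subseteq> support (w i)" if w: "w \<in> U" and i: "i \<in> {1..n}" for w i
    proof
      fix a assume a: "a \<in> support (x i)"
      have "0 < w i a" using near[OF w i a] \<epsilon>_le[OF i a] \<delta>(3) \<epsilon> by simp
      then show "a \<in> support (w i)" by (simp add: support_def)
    qed
    have uX: "u \<in> X" "v \<in> X" using uv by (simp_all add: U_def)
    have base: "cube_dist n w x \<le> \<epsilon> / 4" if w: "w \<in> U" for w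
      using cube_dist_base_le[OF x, of w \<delta>] sub[OF w] near[OF w] w \<delta> by (simp add: U_def)
    have "cube_dist n x v = cube_dist n v x"
      by (simp add: cube_dist_def L2_set_def power2_commute)
    then have "path_dist n ?C u v \<le> ereal (cube_dist n u x + cube_dist n v x)"
      using path_dist_le_through_base[OF x uX(1) sub[OF uv(1)] uX(2) sub[OF uv(2)]] by simp
    then have short: "path_dist n ?C u v \<le> ereal (\<epsilon> / 2)"
      using base[OF uv(1)] base[OF uv(2)]
      by (elim order_trans) simp
    show "path_dist n ?C u v \<le> path_dist n ?C' (F u) (F v)"
      unfolding path_dist_def[of n ?C']
    proof (rule INF_greatest)
      fix ps assume ps: "ps \<in> strings n ?C' (F u) (F v)"
      show "path_dist n ?C u v \<le> ereal (string_length n ps)"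
      proof (cases "\<epsilon> / 2 \<le> string_length n ps")
        case True
        then show ?thesis using short by (elim order_trans) simp
      next
        case False
        have "p \<in> star x" if p: "p \<in> set ps" for p
          unfolding star_def
        proof (intro CollectI ballI subsetI)
          fix i w assume i: "i \<in> {1..n}" and "w \<in> f ` support (x i)"
          then obtain a where a: "a \<in> support (x i)" "w = f a" by blast
          have "\<bar>p i w - F u i w\<bar> \<le> string_length n ps"
            by (rule abs_weight_diff_le_string_length[of ?C' n "colour_class \<Gamma>A'" "colour_class \<Gamma>B'",
                  OF _ ps p i]) (rule target_cell)
          moreover have "u i a \<le> F u i w"
            using le_push_forward[OF weight_points[OF uX(1) i], of a f] i a by (simp add: push_point_def)
          moreover have "\<epsilon> - \<epsilon> / 4 < u i a"
            using near[OF uv(1) i a(1)] \<epsilon>_le[OF i a(1)] \<delta>(3) by simp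
          ultimately have "0 < p i w" using False \<epsilon> by linarith
          then show "w \<in> support (p i)" by (simp add: support_def)
        qed
        then show ?thesis using path_dist_le_string_in_star[OF x uX ps] by blast
      qed
    qed
  qed
  ultimately show "\<exists>U. openin (top_of_set X) U \<and> x \<in> U \<and>
      (\<forall>u\<in>U. \<forall>v\<in>U. path_dist n ?C' (F u) (F v) = path_dist n ?C u v)"
    by blast
qed

end

section \<open>The canonical completion\<close>

text \<open>A vertex of the completion is a pair \<open>(u, w)\<close> of vertices, one of the whole complex and one of the
  full subcomplex on \<open>V\<close>. Moving \<open>u\<close> along an edge \<open>{u, u'}\<close> of factor \<open>i\<close> flips \<open>w\<close> along the same edge
  whenever the subcomplex has that edge at \<open>w\<close>, and leaves \<open>w\<close> unchanged otherwise. Flips in different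
  factors that span a square of the whole complex commute by flagness.\<close>

locale completion = graph_product n G adj
  for n :: nat and G :: "nat \<Rightarrow> 'v set set" and adj :: "'v \<Rightarrow> 'v \<Rightarrow> bool" +
  fixes V :: "'v set"
begin

text \<open>The full subcomplex on \<open>V\<close> has the edge \<open>{u, u'}\<close> of factor
  \<open>i\<close> at the second coordinates occurring in the other factors of \<open>S\<close>.
  Quantifying over all of \<open>S\<close> makes the condition independent of a choice of vertex in
  the cell.\<close>

definition active :: "(nat \<Rightarrow> ('v \<times> 'v) set) \<Rightarrow> nat \<Rightarrow> 'v \<Rightarrow> 'v \<Rightarrow> bool" where
  "active S i u u' \<longleftrightarrow> u \<in> V \<and> u' \<in> V \<and>
     (\<forall>j\<in>{1..n}. j \<noteq> i \<longrightarrow> (\<forall>s\<in>S j. adj u (snd s) \<and> adj u' (snd s)))"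

definition move :: "(nat \<Rightarrow> ('v \<times> 'v) set) \<Rightarrow> nat \<Rightarrow> 'v \<Rightarrow> 'v \<Rightarrow> 'v \<Rightarrow> 'v" where
  "move S i u u' w = (if active S i u u' \<and> (w = u \<or> w = u') then (if w = u then u' else u) else w)"

text \<open>In each factor a cell is the graph of a map from first to second coordinates. So the
  first projection preserves dimension, as a covering must, while the second may collapse an edge,
  as a retraction may.\<close>

definition cover_cell :: "(nat \<Rightarrow> ('v \<times> 'v) set) \<Rightarrow> bool" where
  "cover_cell S \<longleftrightarrow> pcell (\<lambda>i. fst ` S i) \<and> pcell (\<lambda>i. snd ` S i) \<and> (\<forall>i\<in>{1..n}. snd ` S i \<subseteq> V) \<and>
     (\<forall>i\<in>{1..n}. \<forall>r\<in>S i. \<forall>s\<in>S i. r \<noteq> s \<longrightarrow>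
        fst r \<noteq> fst s \<and> snd s = move S i (fst r) (fst s) (snd r))"

lemma cover_cellD:
  assumes "cover_cell S"
  shows "pcell (\<lambda>i. fst ` S i)" "pcell (\<lambda>i. snd ` S i)"
    and "i \<in> {1..n} \<Longrightarrow> r \<in> S i \<Longrightarrow> snd r \<in> V"
    and "i \<in> {1..n} \<Longrightarrow> r \<in> S i \<Longrightarrow> s \<in> S i \<Longrightarrow> fst r = fst s \<Longrightarrow> r = s"
    and "i \<in> {1..n} \<Longrightarrow> r \<in> S i \<Longrightarrow> s \<in> S i \<Longrightarrow> r \<noteq> s \<Longrightarrow> snd s = move S i (fst r) (fst s) (snd r)"
    and "i \<in> {1..n} \<Longrightarrow> S i \<noteq> {}"
proof -
  show 1: "pcell (\<lambda>i. fst ` S i)" and "pcell (\<lambda>i. snd ` S i)"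
    using assms by (simp_all add: cover_cell_def)
  show "snd r \<in> V" if "i \<in> {1..n}" "r \<in> S i"
    using assms that unfolding cover_cell_def by (meson image_eqI subsetD)
  show "r = s" if "i \<in> {1..n}" "r \<in> S i" "s \<in> S i" "fst r = fst s"
    using assms that unfolding cover_cell_def by metis
  show "snd s = move S i (fst r) (fst s) (snd r)" if "i \<in> {1..n}" "r \<in> S i" "s \<in> S i" "r \<noteq> s"
    using assms that unfolding cover_cell_def by metis
  show "S i \<noteq> {}" if "i \<in> {1..n}"
    using 1 that cell_nonempty[of "fst ` S i" i] by (simp add: product_cell_def)
qed

lemma adjD: "pcell P \<Longrightarrow> i \<in> {1..n} \<Longrightarrow> j \<in> {1..n} \<Longrightarrow> j \<noteq> i \<Longrightarrow> u \<in> P i \<Longrightarrow> v \<in> P j \<Longrightarrow> adj u v"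
  by (simp add: product_cell_def)

lemma active_commute: "active S i u u' = active S i u' u"
  by (auto simp: active_def)

text \<open>A flip is undone on the way back, so an edge of the completion can be read from either
  end.\<close>

lemma move_move:
  assumes "u \<noteq> u'"
  shows "move S i u' u (move S i u u' w) = w"
  using assms by (auto simp: move_def active_commute)

lemma move_cases:
  obtains "move S i u u' w = w"
  | "active S i u u'" "w = u" "move S i u u' w = u'" | "active S i u u'" "w = u'" "move S i u u' w = u"
  unfolding move_def by (cases "active S i u u'"; cases "w = u"; cases "w = u'") auto

text \<open>The commutation of flips in different factors. A second coordinate new in
  \<open>S\<close> is a vertex of \<open>P\<close> in its own factor, hence compatible with both
  ends of the edge in factor \<open>i\<close>, because \<open>P\<close> is a cell.\<close>

lemma active_eq:
  assumes P: "pcell P" and sub: "\<And>j. j \<in> {1..n} \<Longrightarrow> S0 j \<subseteq> S j"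
    and snd: "\<And>j s. j \<in> {1..n} \<Longrightarrow> s \<in> S j \<Longrightarrow> snd s \<in> snd ` S0 j \<or> snd s \<in> P j"
    and i: "i \<in> {1..n}" and u: "u \<in> P i" "u' \<in> P i"
  shows "active S i u u' = active S0 i u u'"
proof
  assume "active S i u u'"
  then show "active S0 i u u'" using sub unfolding active_def by (meson subsetD)
next
  assume a: "active S0 i u u'"
  have "adj u (snd s) \<and> adj u' (snd s)" if j: "j \<in> {1..n}" "j \<noteq> i" and s: "s \<in> S j" for j s
    using snd[OF j(1) s]
  proof
    assume "snd s \<in> snd ` S0 j"
    then obtain s0 where "s0 \<in> S0 j" "snd s = snd s0" by blast
    then show ?thesis using a j unfolding active_def by simp
  next
    assume "snd s \<in> P j"
    then show ?thesis using adjD[OF P i j] u by blast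
  qed
  then show "active S i u u'" using a unfolding active_def by blast
qed

text \<open>A flip only exchanges the ends of the first-coordinate edge. So a second coordinate that
  changes within a cell also occurs as a first coordinate, which is the situation of
  \<open>active_eq\<close>.\<close>

lemma cover_cell_snd:
  assumes S: "cover_cell S" and i: "i \<in> {1..n}" and r0: "r0 \<in> S i" and r: "r \<in> S i"
  shows "snd r = snd r0 \<or> snd r \<in> fst ` S i"
proof (cases "r = r0")
  case False
  then have "snd r = move S i (fst r0) (fst r) (snd r0)" using cover_cellD(5)[OF S i r0 r] by simp
  then show ?thesis using r r0 by (cases rule: move_cases[of S i "fst r0" "fst r" "snd r0"]) auto
qed simp

lemma cover_cell_active_eq:
  assumes S: "cover_cell S" and sub: "\<And>j. j \<in> {1..n} \<Longrightarrow> S0 j \<subseteq> S j" "\<And>j. j \<in> {1..n} \<Longrightarrow> S0 j \<noteq> {}"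
    and i: "i \<in> {1..n}" and rs: "r \<in> S i" "s \<in> S i"
  shows "active S i (fst r) (fst s) = active S0 i (fst r) (fst s)"
proof (rule active_eq[OF cover_cellD(1)[OF S] sub(1) _ i])
  show "snd s \<in> snd ` S0 j \<or> snd s \<in> fst ` S j" if j: "j \<in> {1..n}" and s: "s \<in> S j" for j s
  proof -
    obtain r0 where r0: "r0 \<in> S0 j" using sub(2)[OF j] by blast
    then have "r0 \<in> S j" using sub(1)[OF j] by blast
    then show ?thesis using cover_cell_snd[OF S j _ s, of r0] r0 by auto
  qed
qed (use rs in auto)

lemma cover_cell_subset:
  assumes S: "cover_cell S" and sub: "\<And>j. j \<in> {1..n} \<Longrightarrow> S0 j \<subseteq> S j" "\<And>j. j \<in> {1..n} \<Longrightarrow> S0 j \<noteq> {}"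
  shows "cover_cell S0"
  unfolding cover_cell_def
proof (intro conjI ballI impI)
  show "pcell (\<lambda>i. fst ` S0 i)" "pcell (\<lambda>i. snd ` S0 i)"
    by (rule pcell_subset[OF cover_cellD(1)[OF S]] pcell_subset[OF cover_cellD(2)[OF S]];
        simp add: sub image_mono)+
  show "snd ` S0 i \<subseteq> V" if "i \<in> {1..n}" for i
    using sub(1)[OF that] cover_cellD(3)[OF S that] by blast
  fix i r s assume i: "i \<in> {1..n}" and rs: "r \<in> S0 i" "s \<in> S0 i" "r \<noteq> s"
  have rs': "r \<in> S i" "s \<in> S i" using rs sub(1)[OF i] by auto
  show "fst r \<noteq> fst s" using cover_cellD(4)[OF S i rs'] rs(3) by blast
  show "snd s = move S0 i (fst r) (fst s) (snd r)"
    using cover_cellD(5)[OF S i rs' rs(3)] cover_cell_active_eq[OF S sub i rs'] by (simp add: move_def)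
qed

text \<open>The only possible second coordinate over \<open>u\<close> in a cell containing
  \<open>S0\<close>: vertices of \<open>S0\<close> keep theirs, and a new vertex is reached by one
  move. Factors are at most edges, so next to a new vertex there is room for just one vertex of
  \<open>S0\<close>, and the choice of \<open>r0\<close> is harmless.\<close>

definition extend :: "(nat \<Rightarrow> ('v \<times> 'v) set) \<Rightarrow> nat \<Rightarrow> 'v \<Rightarrow> 'v" where
  "extend S0 i u = (let r0 = SOME r. r \<in> S0 i in
     if u \<in> fst ` S0 i then snd (SOME r. r \<in> S0 i \<and> fst r = u) else move S0 i (fst r0) u (snd r0))"

lemma extend_fst:
  assumes "cover_cell S0" "i \<in> {1..n}" "r \<in> S0 i"
  shows "extend S0 i (fst r) = snd r"
proof -
  have "(SOME s. s \<in> S0 i \<and> fst s = fst r) = r"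
    using assms(3) cover_cellD(4)[OF assms(1,2) _ assms(3)] by (intro some_equality) auto
  then show ?thesis using assms(3) by (simp add: extend_def)
qed

lemma extend_move:
  assumes "cover_cell S0" "i \<in> {1..n}" "u \<notin> fst ` S0 i"
  obtains r0 where "r0 \<in> S0 i" "extend S0 i u = move S0 i (fst r0) u (snd r0)"
proof
  show "(SOME r. r \<in> S0 i) \<in> S0 i" using cover_cellD(6)[OF assms(1,2)] by (simp add: some_in_eq)
  show "extend S0 i u = move S0 i (fst (SOME r. r \<in> S0 i)) u (snd (SOME r. r \<in> S0 i))"
    by (simp only: extend_def Let_def assms(3) if_False)
qed

text \<open>Uniqueness of lifts: the move from \<open>S0\<close> to \<open>r\<close> is governed by
  the flips active in \<open>S\<close>, and these agree with the flips active in
  \<open>S0\<close>.\<close>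

lemma cover_cell_eq_extend:
  assumes S: "cover_cell S" and S0: "cover_cell S0" and sub: "\<And>j. j \<in> {1..n} \<Longrightarrow> S0 j \<subseteq> S j"
    and i: "i \<in> {1..n}" and r: "r \<in> S i"
  shows "snd r = extend S0 i (fst r)"
proof (cases "fst r \<in> fst ` S0 i")
  case True
  then obtain s where s: "s \<in> S0 i" "fst r = fst s" by blast
  then have "r = s" using cover_cellD(4)[OF S i r] sub[OF i] by blast
  then show ?thesis using extend_fst[OF S0 i s(1)] by simp
next
  case False
  obtain r0 where r0: "r0 \<in> S0 i" "extend S0 i (fst r) = move S0 i (fst r0) (fst r) (snd r0)"
    by (rule extend_move[OF S0 i False])
  have r0S: "r0 \<in> S i" "r0 \<noteq> r" using r0(1) sub[OF i] False by auto
  have "active S i (fst r0) (fst r) = active S0 i (fst r0) (fst r)"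
    by (rule cover_cell_active_eq[OF S sub cover_cellD(6)[OF S0] i r0S(1) r])
  then show ?thesis using cover_cellD(5)[OF S i r0S(1) r r0S(2)] r0(2) by (simp add: move_def)
qed

text \<open>Existence of lifts. With uniqueness it identifies the star of a cell with the star of
  its projection, which is the combinatorial content of the covering property.\<close>

lemma cover_cell_extend:
  assumes S0: "cover_cell S0" and P: "pcell P" and sub: "\<And>j. j \<in> {1..n} \<Longrightarrow> fst ` S0 j \<subseteq> P j"
  shows "cover_cell (\<lambda>i. (\<lambda>u. (u, extend S0 i u)) ` P i)"
proof -
  define S where "S = (\<lambda>i. (\<lambda>u. (u, extend S0 i u)) ` P i)"
  have fstS: "fst ` S j = P j" for j by (force simp: S_def)
  have S0S: "S0 j \<subseteq> S j" if j: "j \<in> {1..n}" for j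
  proof
    fix r assume r: "r \<in> S0 j"
    then have "fst r \<in> P j" using sub[OF j] by blast
    moreover have "r = (fst r, extend S0 j (fst r))" using extend_fst[OF S0 j r] by (simp add: prod_eq_iff)
    ultimately show "r \<in> S j" unfolding S_def by (metis image_eqI)
  qed
  have Pi: "P i \<in> G i" if "i \<in> {1..n}" for i using P that by (simp add: product_cell_def)
  \<comment> \<open>A new vertex appears only in a factor where \<open>S0\<close> is a single vertex
    and \<open>P\<close> is an edge.\<close>
  have new: "\<exists>r0. S0 i = {r0} \<and> P i = {fst r0, fst r} \<and> fst r0 \<noteq> fst r \<and>
      snd r = move S0 i (fst r0) (fst r) (snd r0)"
    if i: "i \<in> {1..n}" and r: "r \<in> S i" "r \<notin> S0 i" for i r
  proof -
    have r_eq: "fst r \<in> P i" "snd r = extend S0 i (fst r)" using r(1) by (auto simp: S_def)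
    have "fst r \<notin> fst ` S0 i"
    proof
      assume "fst r \<in> fst ` S0 i"
      then obtain s where s: "s \<in> S0 i" "fst r = fst s" by blast
      then have "r = s" using r_eq(2) extend_fst[OF S0 i s(1)] by (simp add: prod_eq_iff)
      then show False using s r(2) by simp
    qed
    then obtain r0 where r0: "r0 \<in> S0 i" "snd r = move S0 i (fst r0) (fst r) (snd r0)"
      using extend_move[OF S0 i] r_eq(2) by metis
    have r0P: "fst r0 \<in> P i" "fst r0 \<noteq> fst r"
      using r0(1) sub[OF i] \<open>fst r \<notin> fst ` S0 i\<close> by (metis image_eqI subsetD)+
    have PP: "P i = {fst r0, fst r}" by (rule cell_eq[OF Pi[OF i] r0P(1) r_eq(1) r0P(2)])
    have "s = r0" if s: "s \<in> S0 i" for s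
    proof -
      have "fst s \<in> {fst r0, fst r}" using s sub[OF i] PP by blast
      then have "fst s = fst r0" using s \<open>fst r \<notin> fst ` S0 i\<close> by (metis image_eqI insertE singletonD)
      then show ?thesis using cover_cellD(4)[OF S0 i s r0(1)] by simp
    qed
    then have "S0 i = {r0}" using r0(1) by blast
    then show ?thesis using PP r0P r0(2) by blast
  qed
  \<comment> \<open>If a second coordinate really changes, the old and the new value are the two
    ends of the edge \<open>P i\<close>. Either way the second coordinates form a cell of the
    factor.\<close>
  have newcell: "snd ` S i = snd ` S0 i \<or> snd ` S i \<subseteq> P i" if i: "i \<in> {1..n}" for i
  proof (cases "snd ` S i \<subseteq> snd ` S0 i")
    case True
    then show ?thesis using S0S[OF i] by blast
  next
    case False
    then obtain r where r: "r \<in> S i" "snd r \<notin> snd ` S0 i" by blast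
    then obtain r0 where r0: "S0 i = {r0}" "P i = {fst r0, fst r}"
      "snd r = move S0 i (fst r0) (fst r) (snd r0)"
      using new[OF i r(1)] by blast
    have "snd r \<noteq> snd r0" using r(2) r0(1) by auto
    then have "snd r0 \<in> P i" "snd r \<in> P i"
      using r0 by (cases rule: move_cases[of S0 i "fst r0" "fst r" "snd r0"]; simp)+
    moreover have "s = r0 \<or> s = r" if s: "s \<in> S i" for s
    proof -
      have "fst s \<in> {fst r0, fst r}" using s fstS[of i] r0(2) by blast
      moreover have "snd t = extend S0 i (fst t)" if "t \<in> S i" for t using that by (auto simp: S_def)
      moreover have "r0 \<in> S i" using S0S[OF i] r0(1) by blast
      ultimately show ?thesis using s r(1) by (metis insertE prod_eqI singletonD)
    qed
    ultimately show ?thesis by blast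
  qed
  have sndS: "snd r \<in> snd ` S0 i \<or> (snd r \<in> P i \<and> snd r \<in> V \<and>
      (\<forall>j\<in>{1..n}. j \<noteq> i \<longrightarrow> (\<forall>s\<in>S0 j. adj (snd r) (snd s))))"
    if i: "i \<in> {1..n}" and r: "r \<in> S i" for i r
  proof (cases "r \<in> S0 i")
    case False
    then obtain r0 where r0: "S0 i = {r0}" "P i = {fst r0, fst r}" "snd r = move S0 i (fst r0) (fst r) (snd r0)"
      using new[OF i r] by blast
    show ?thesis
    proof (cases rule: move_cases[of S0 i "fst r0" "fst r" "snd r0"])
      case 1
      then show ?thesis using r0 by simp
    next
      case 2
      then show ?thesis using r0 by (simp add: active_def)
    next
      case 3
      then show ?thesis using r0 by (simp add: active_def)
    qed
  qed simp
  have act: "active S i u u' = active S0 i u u'" if "i \<in> {1..n}" "u \<in> P i" "u' \<in> P i" for i u u'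
    by (rule active_eq[OF P S0S _ that]) (use sndS in blast)+
  have "cover_cell S"
    unfolding cover_cell_def
  proof (intro conjI ballI impI)
    show "pcell (\<lambda>i. fst ` S i)" unfolding fstS by (rule P)
    show "pcell (\<lambda>i. snd ` S i)"
      unfolding product_cell_def
    proof (intro ballI conjI impI)
      fix i assume i: "i \<in> {1..n}"
      have "S i \<noteq> {}" using S0S[OF i] cover_cellD(6)[OF S0 i] by blast
      then show "snd ` S i \<in> G i"
        using newcell[OF i] cell_subset[OF Pi[OF i]] cover_cellD(2)[OF S0] i by (auto simp: product_cell_def)
    next
      fix i j a b assume i: "i \<in> {1..n}" and j: "j \<in> {1..n}" "j \<noteq> i"
        and "a \<in> snd ` S i" "b \<in> snd ` S j"
      then obtain r s where r: "r \<in> S i" "a = snd r" and s: "s \<in> S j" "b = snd s" by blast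
      have rr: "a \<in> snd ` S0 i \<or> (a \<in> P i \<and> (\<forall>s\<in>S0 j. adj a (snd s)))"
        using sndS[OF i r(1)] r(2) j by blast
      have ss: "b \<in> snd ` S0 j \<or> (b \<in> P j \<and> (\<forall>s\<in>S0 i. adj b (snd s)))"
        using sndS[OF j(1) s(1)] s(2) i not_sym[OF j(2)] by blast
      \<comment> \<open>Two old coordinates are compatible by \<open>S0\<close>, two new ones
        because both lie in \<open>P\<close>, and a new one with an old one because the flip that
        produced it was active.\<close>
      show "adj a b"
      proof (cases "a \<in> snd ` S0 i")
        case True
        then show ?thesis using ss adjD[OF cover_cellD(2)[OF S0] i j] adj_sym by blast
      next
        case False
        then show ?thesis using rr ss adjD[OF P i j] by blast
      qed
    qed
    show "snd ` S i \<subseteq> V" if i: "i \<in> {1..n}" for i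
    proof
      fix a assume "a \<in> snd ` S i"
      then obtain r where r: "r \<in> S i" "a = snd r" by blast
      have "snd ` S0 i \<subseteq> V" using S0 i by (simp add: cover_cell_def)
      then show "a \<in> V" using sndS[OF i r(1)] r(2) by blast
    qed
    fix i r s assume i: "i \<in> {1..n}" and rs: "r \<in> S i" "s \<in> S i" "r \<noteq> s"
    show ne: "fst r \<noteq> fst s" using rs by (auto simp: S_def)
    have "fst r \<in> P i" "fst s \<in> P i" using rs by (auto simp: S_def)
    then have mv: "move S i (fst r) (fst s) w = move S0 i (fst r) (fst s) w" for w
      using act[OF i] by (simp add: move_def)
    \<comment> \<open>If \<open>r\<close> and \<open>s\<close> are not both old, one of them is the
      unique vertex of \<open>S0 i\<close>. In the last case the edge is traversed
      backwards.\<close>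
    consider "r \<in> S0 i" "s \<in> S0 i" | "s \<notin> S0 i" | "s \<in> S0 i" "r \<notin> S0 i" by blast
    then show "snd s = move S i (fst r) (fst s) (snd r)"
      unfolding mv
    proof cases
      case 1
      then show "snd s = move S0 i (fst r) (fst s) (snd r)" using cover_cellD(5)[OF S0 i _ _ rs(3)] by blast
    next
      case 2
      then obtain r0 where r0: "S0 i = {r0}" "P i = {fst r0, fst s}" "snd s = move S0 i (fst r0) (fst s) (snd r0)"
        using new[OF i rs(2)] by blast
      have "fst r = fst r0" using \<open>fst r \<in> P i\<close> ne r0(2) by blast
      moreover have "snd t = extend S0 i (fst t)" if "t \<in> S i" for t using that by (auto simp: S_def)
      ultimately have "r = r0" using rs(1) S0S[OF i] r0(1) by (metis insert_subset prod_eqI)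
      then show "snd s = move S0 i (fst r) (fst s) (snd r)" using r0(3) by simp
    next
      case 3
      then obtain r0 where r0: "S0 i = {r0}" "snd r = move S0 i (fst r0) (fst r) (snd r0)"
        using new[OF i rs(1)] by blast
      then have "r0 = s" using 3 by simp
      then show "snd s = move S0 i (fst r) (fst s) (snd r)"
        using r0(2) move_move[of "fst s" "fst r" S0 i "snd s"] ne by simp
    qed
  qed
  then show ?thesis by (simp add: S_def)
qed

text \<open>Along the edges of the subcomplex itself every flip is active, so \<open>w\<close>
  follows \<open>u\<close>. This embeds the source in the completion.\<close>

lemma cover_cell_diagonal:
  assumes P: "pcell P" and V: "\<And>i. i \<in> {1..n} \<Longrightarrow> P i \<subseteq> V"
  shows "cover_cell (\<lambda>i. (\<lambda>u. (u, u)) ` P i)"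
  unfolding cover_cell_def
proof (intro conjI ballI impI)
  show "pcell (\<lambda>i. fst ` (\<lambda>u. (u, u)) ` P i)" "pcell (\<lambda>i. snd ` (\<lambda>u. (u, u)) ` P i)"
    using P by (simp_all add: image_image)
  show "snd ` (\<lambda>u. (u, u)) ` P i \<subseteq> V" if "i \<in> {1..n}" for i
    using V[OF that] by (simp add: image_image)
  fix i r s assume i: "i \<in> {1..n}" and "r \<in> (\<lambda>u. (u, u)) ` P i" "s \<in> (\<lambda>u. (u, u)) ` P i" and ne: "r \<noteq> s"
  then obtain u u' where u: "u \<in> P i" "r = (u, u)" and u': "u' \<in> P i" "s = (u', u')" by blast
  show "fst r \<noteq> fst s" using ne u u' by simp
  have "adj u (snd t) \<and> adj u' (snd t)" if "j \<in> {1..n}" "j \<noteq> i" "t \<in> (\<lambda>u. (u, u)) ` P j" for j t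
    using adjD[OF P i that(1,2)] u u' that(3) by auto
  then have "active (\<lambda>i. (\<lambda>u. (u, u)) ` P i) i u u'"
    using V[OF i] u u' unfolding active_def by blast
  then show "snd s = move (\<lambda>i. (\<lambda>u. (u, u)) ` P i) i (fst r) (fst s) (snd r)"
    using u u' by (simp add: move_def)
qed

lemma local_family_cover_cell: "local_family n cover_cell"
  unfolding local_family_def
proof (intro allI impI)
  fix S T :: "nat \<Rightarrow> ('v \<times> 'v) set" assume eq: "\<forall>i\<in>{1..n}. S i = T i"
  then have "active S = active T" by (auto simp: active_def fun_eq_iff)
  then have "move S = move T" by (auto simp: move_def fun_eq_iff)
  moreover have "pcell (\<lambda>i. h ` S i) = pcell (\<lambda>i. h ` T i)" for h
    by (rule local_family_pcell[unfolded local_family_def, rule_format]) (simp add: eq)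
  ultimately show "cover_cell S = cover_cell T" using eq by (simp add: cover_cell_def)
qed

lemma finite_family_cover_cell: "finite_family n cover_cell"
  unfolding finite_family_def
proof
  fix i assume i: "i \<in> {1..n}"
  have "S i \<subseteq> \<Union>(G i) \<times> \<Union>(G i)" if S: "cover_cell S" for S
  proof
    fix r assume r: "r \<in> S i"
    have "fst ` S i \<in> G i" "snd ` S i \<in> G i"
      using cover_cellD(1,2)[OF S] i by (simp_all add: product_cell_def)
    then have "fst r \<in> \<Union>(G i)" "snd r \<in> \<Union>(G i)" using r by blast+
    then show "r \<in> \<Union>(G i) \<times> \<Union>(G i)" by (simp add: mem_Times_iff)
  qed
  then have "(\<Union>S\<in>Collect cover_cell. S i) \<subseteq> \<Union>(G i) \<times> \<Union>(G i)" by blast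
  then show "finite (\<Union>S\<in>Collect cover_cell. S i)"
    by (rule finite_subset) (intro finite_cartesian_product finite_graph)
qed

end

section \<open>The projection of the completion as a covering\<close>

lemma openin_support_star:
  fixes S :: "(nat \<Rightarrow> 'v \<Rightarrow> real) set"
  assumes "\<And>i. i \<in> {1..n} \<Longrightarrow> finite (K i)"
  shows "openin (top_of_set S) {p \<in> S. \<forall>i\<in>{1..n}. K i \<subseteq> support (p i)}"
proof -
  have "open (\<Inter>i\<in>{1..n}. \<Inter>v\<in>K i. {p :: nat \<Rightarrow> 'v \<Rightarrow> real. p i v \<noteq> 0})"
    using assms by (intro open_INT ballI open_Collect_neq continuous_on_coordinate continuous_on_const) auto
  then have "openin (top_of_set S) (S \<inter> (\<Inter>i\<in>{1..n}. \<Inter>v\<in>K i. {p. p i v \<noteq> 0}))"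
    by (rule openin_open_Int)
  moreover have "S \<inter> (\<Inter>i\<in>{1..n}. \<Inter>v\<in>K i. {p. p i v \<noteq> 0}) = {p \<in> S. \<forall>i\<in>{1..n}. K i \<subseteq> support (p i)}"
    by (auto simp: support_def)
  ultimately show ?thesis by simp
qed

context completion
begin

abbreviation "proj \<equiv> push_point n (\<lambda>_. fst :: 'v \<times> 'v \<Rightarrow> 'v)"

definition "sect r0 = push_point n (\<lambda>i u. (u, extend (\<lambda>i. support (r0 i)) i u))"

text \<open>The open star of the carrier of \<open>r0\<close>. Such stars are open because
  nonvanishing of finitely many weights is, and lifts of cells are unique on them.\<close>

definition "sheet r0 = {r \<in> points n cover_cell. \<forall>i\<in>{1..n}. support (r0 i) \<subseteq> support (r i)}"

definition "base_star p0 = {p \<in> points n pcell. \<forall>i\<in>{1..n}. support (p0 i) \<subseteq> support (p i)}"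

lemma proj_in_points:
  assumes r: "r \<in> points n cover_cell"
  shows "proj r \<in> points n pcell"
  using push_point_in_points[OF r local_family_pcell] cover_cellD(1)[OF supports_points[OF r]] by simp

lemma support_proj:
  "r \<in> points n cover_cell \<Longrightarrow> i \<in> {1..n} \<Longrightarrow> support (proj r i) = fst ` support (r i)"
  using support_push_point[of i n r] weight_points[of r n] by simp

lemma proj_sheet:
  assumes r: "r \<in> sheet r0" and r0: "r0 \<in> points n cover_cell"
  shows "proj r \<in> base_star (proj r0)"
  using r r0 unfolding base_star_def sheet_def by (auto simp: proj_in_points support_proj)

lemma sect_in_sheet:
  assumes r0: "r0 \<in> points n cover_cell" and p: "p \<in> base_star (proj r0)"
  shows "sect r0 p \<in> sheet r0" "proj (sect r0 p) = p"
proof -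
  note S0 = supports_points[OF r0]
  have sub: "fst ` support (r0 i) \<subseteq> support (p i)" if "i \<in> {1..n}" for i
    using p r0 that by (auto simp: base_star_def support_proj)
  have pX: "p \<in> points n pcell" using p by (simp add: base_star_def)
  have "sect r0 p \<in> points n cover_cell"
    unfolding sect_def
    by (rule push_point_in_points[OF pX local_family_cover_cell])
      (rule cover_cell_extend[OF S0 supports_points[OF pX] sub])
  moreover have "support (r0 i) \<subseteq> support (sect r0 p i)" if i: "i \<in> {1..n}" for i
  proof
    fix r assume r: "r \<in> support (r0 i)"
    have 1: "r = (fst r, extend (\<lambda>i. support (r0 i)) i (fst r))"
      using extend_fst[OF S0 i] r by (simp add: prod_eq_iff)
    have 2: "fst r \<in> support (p i)" using sub[OF i] r by blast
    have 3: "support (sect r0 p i) = (\<lambda>u. (u, extend (\<lambda>i. support (r0 i)) i u)) ` support (p i)"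
      unfolding sect_def by (rule support_push_point[of i n p, OF i weight_points[OF pX i]])
    show "r \<in> support (sect r0 p i)" unfolding 3 by (rule image_eqI[where x = "fst r"]) (rule 1, rule 2)
  qed
  ultimately show "sect r0 p \<in> sheet r0" by (simp add: sheet_def)
  show "proj (sect r0 p) = p"
    unfolding sect_def push_point_push_point[OF pX] by (rule push_point_ident[OF pX]) simp
qed

lemma sect_proj:
  assumes r0: "r0 \<in> points n cover_cell" and r: "r \<in> sheet r0"
  shows "sect r0 (proj r) = r"
proof -
  have rC: "r \<in> points n cover_cell" and sub: "\<And>i. i \<in> {1..n} \<Longrightarrow> support (r0 i) \<subseteq> support (r i)"
    using r by (auto simp: sheet_def)
  show ?thesis
    unfolding sect_def push_point_push_point[OF rC]
  proof (rule push_point_ident[OF rC])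
    fix i v assume "i \<in> {1..n}" "v \<in> support (r i)"
    then have "snd v = extend (\<lambda>i. support (r0 i)) i (fst v)"
      using cover_cell_eq_extend[OF supports_points[OF rC] supports_points[OF r0] sub, of i v] by simp
    then show "((\<lambda>u. (u, extend (\<lambda>i. support (r0 i)) i u)) \<circ> fst) v = v"
      by (simp add: prod_eq_iff)
  qed
qed

definition "branch r i u = (SOME s. s \<in> support (r i) \<and> fst s = u)"

lemma branch_fst:
  assumes r: "r \<in> points n cover_cell" and i: "i \<in> {1..n}" and s: "s \<in> support (r i)"
  shows "branch r i (fst s) = s"
  unfolding branch_def
proof (rule some_equality)
  show "t = s" if "t \<in> support (r i) \<and> fst t = fst s" for t
    using cover_cellD(4)[OF supports_points[OF r] i, of t s] s that by simp
qed (simp add: s)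

text \<open>The point \<open>r\<close> selects one lift of every vertex of \<open>proj r0\<close>,
  and \<open>r0\<close> must use these lifts. So sheets over the same point that share
  \<open>r\<close> coincide, which gives disjointness.\<close>

lemma sheet_unique:
  assumes r0: "r0 \<in> points n cover_cell" and r: "r \<in> sheet r0"
  shows "push_point n (branch r) (proj r0) = r0"
  unfolding push_point_push_point[OF r0]
proof (rule push_point_ident[OF r0])
  fix i v assume i: "i \<in> {1..n}" and v: "v \<in> support (r0 i)"
  have "r \<in> points n cover_cell" "v \<in> support (r i)" using r i v unfolding sheet_def by blast+
  then show "(branch r i \<circ> fst) v = v" using branch_fst[of r i v] i by simp
qed

text \<open>The lifts of the vertices of \<open>p0\<close> inside the carrier of \<open>r\<close>
  span a face of it; \<open>r0\<close> is the point of that face with the weights of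
  \<open>p0\<close>.\<close>

lemma sheet_exists:
  assumes r: "r \<in> points n cover_cell" and p0: "p0 \<in> points n pcell" and star: "proj r \<in> base_star p0"
  shows "\<exists>r0\<in>points n cover_cell. proj r0 = p0 \<and> r \<in> sheet r0"
proof
  define r0 where "r0 = push_point n (branch r) p0"
  have br: "branch r i u \<in> support (r i) \<and> fst (branch r i u) = u"
    if i: "i \<in> {1..n}" and u: "u \<in> support (p0 i)" for i u
  proof -
    have "u \<in> fst ` support (r i)" using star i u support_proj[OF r i] unfolding base_star_def by blast
    then obtain s where "s \<in> support (r i)" "u = fst s" by blast
    then show ?thesis using branch_fst[OF r i] by simp
  qed
  have sub: "branch r i ` support (p0 i) \<subseteq> support (r i)" if "i \<in> {1..n}" for i
    using br[OF that] by blast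
  have "support (p0 i) \<noteq> {}" if "i \<in> {1..n}" for i
    using support_nonempty[OF weight_points[OF p0 that]] .
  then have "cover_cell (\<lambda>i. branch r i ` support (p0 i))"
    using cover_cell_subset[OF supports_points[OF r], of "\<lambda>i. branch r i ` support (p0 i)"] sub by simp
  then show r0: "r0 \<in> points n cover_cell"
    unfolding r0_def by (rule push_point_in_points[OF p0 local_family_cover_cell])
  have "proj r0 = p0"
    unfolding r0_def push_point_push_point[OF p0] by (rule push_point_ident[OF p0]) (simp add: br)
  moreover have "support (r0 i) \<subseteq> support (r i)" if i: "i \<in> {1..n}" for i
    using sub[OF i] support_push_point[of i n p0 "branch r", OF i weight_points[OF p0 i]] by (simp add: r0_def)
  ultimately show "proj r0 = p0 \<and> r \<in> sheet r0" using r by (simp add: sheet_def)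
qed

text \<open>Surjectivity without connectedness: a vertex of the carrier of \<open>p\<close>, paired
  with any vertex of the subcomplex, is a vertex of the completion, and the section through it
  reaches \<open>p\<close>. The point \<open>q\<close> supplies a vertex of the subcomplex.\<close>

lemma fibre_nonempty:
  assumes q: "q \<in> points n pcell" "\<And>i. i \<in> {1..n} \<Longrightarrow> support (q i) \<subseteq> V" and p: "p \<in> points n pcell"
  shows "p \<in> proj ` points n cover_cell"
proof -
  define a where "a i = (SOME u. u \<in> support (p i))" for i
  define b where "b i = (SOME u. u \<in> support (q i))" for i
  define r0 where "r0 = (\<lambda>i\<in>{1..n}. \<lambda>s. if s = (a i, b i) then 1 else 0 :: real)"
  have a: "a i \<in> support (p i)" and b: "b i \<in> support (q i)" if "i \<in> {1..n}" for i
    using support_nonempty[OF weight_points[OF p that]] support_nonempty[OF weight_points[OF q(1) that]]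
    by (simp_all add: a_def b_def some_in_eq)
  have supp: "support (r0 i) = {(a i, b i)}" if "i \<in> {1..n}" for i
    using that by (auto simp: r0_def support_def)
  have w: "weight (r0 i)" if "i \<in> {1..n}" for i
    unfolding weight_def supp[OF that] using that by (simp add: r0_def)
  have "pcell (\<lambda>i. fst ` support (r0 i))"
    by (rule pcell_subset[OF supports_points[OF p]]) (simp_all add: supp a)
  moreover have "pcell (\<lambda>i. snd ` support (r0 i))"
    by (rule pcell_subset[OF supports_points[OF q(1)]]) (simp_all add: supp b)
  moreover have "snd ` support (r0 i) \<subseteq> V" if "i \<in> {1..n}" for i
    using q(2)[OF that] b[OF that] by (auto simp: supp[OF that])
  ultimately have "cover_cell (\<lambda>i. support (r0 i))"
    unfolding cover_cell_def by (simp add: supp)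
  then have r0: "r0 \<in> points n cover_cell" using w by (simp add: points_def r0_def)
  have "p \<in> base_star (proj r0)"
    using p a by (simp add: base_star_def support_proj[OF r0] supp)
  then show ?thesis using sect_in_sheet[OF r0] by (metis (no_types, lifting) image_eqI mem_Collect_eq sheet_def)
qed

lemma covering_space_proj:
  assumes q: "q \<in> points n pcell" "\<And>i. i \<in> {1..n} \<Longrightarrow> support (q i) \<subseteq> V"
  shows "covering_space (points n cover_cell) proj (points n pcell)"
proof
  let ?C = "points n cover_cell" and ?X = "points n pcell"
  show cont: "continuous_on ?C proj" by (rule continuous_on_push_point[OF finite_family_cover_cell])
  show "proj ` ?C = ?X" using proj_in_points fibre_nonempty[OF q] by blast
  fix p0 assume p0: "p0 \<in> ?X"
  define v where "v = sheet ` {r0 \<in> ?C. proj r0 = p0}"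
  show "\<exists>T. p0 \<in> T \<and> openin (top_of_set ?X) T \<and> (\<exists>v. \<Union>v = ?C \<inter> proj -` T \<and>
      (\<forall>u\<in>v. openin (top_of_set ?C) u) \<and> pairwise disjnt v \<and> (\<forall>u\<in>v. \<exists>q. homeomorphism u T proj q))"
  proof (intro exI[of _ "base_star p0"] exI[of _ v] conjI ballI)
    show "p0 \<in> base_star p0" using p0 by (simp add: base_star_def)
    show "openin (top_of_set ?X) (base_star p0)"
      unfolding base_star_def
      by (rule openin_support_star) (rule finite_support[OF weight_points[OF p0]])
    show "\<Union>v = ?C \<inter> proj -` base_star p0"
    proof (intro equalityI subsetI)
      fix r assume "r \<in> \<Union>v"
      then obtain r0 where "r0 \<in> ?C" "proj r0 = p0" "r \<in> sheet r0" by (auto simp: v_def)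
      then show "r \<in> ?C \<inter> proj -` base_star p0" using proj_sheet[of r r0] by (auto simp: sheet_def)
    next
      fix r assume "r \<in> ?C \<inter> proj -` base_star p0"
      then show "r \<in> \<Union>v" using sheet_exists[OF _ p0, of r] by (auto simp: v_def)
    qed
    show "openin (top_of_set ?C) u" if "u \<in> v" for u
    proof -
      obtain r0 where "r0 \<in> ?C" "u = sheet r0" using \<open>u \<in> v\<close> by (auto simp: v_def)
      then show ?thesis
        unfolding sheet_def using openin_support_star[of n "\<lambda>i. support (r0 i)"]
        by (simp add: finite_support weight_points)
    qed
    show "pairwise disjnt v"
      unfolding pairwise_def
    proof (intro ballI impI)
      fix s t assume "s \<in> v" "t \<in> v" "s \<noteq> t"
      then obtain r0 r1 where r: "r0 \<in> ?C" "proj r0 = p0" "s = sheet r0" "r1 \<in> ?C" "proj r1 = p0" "t = sheet r1"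
        by (auto simp: v_def)
      have "r0 = r1" if "r \<in> s" "r \<in> t" for r
        using sheet_unique[OF r(1), of r] sheet_unique[OF r(4), of r] r that by simp
      then show "disjnt s t" using r \<open>s \<noteq> t\<close> by (auto simp: disjnt_def)
    qed
    fix u assume "u \<in> v"
    then obtain r0 where r0: "r0 \<in> ?C" "proj r0 = p0" "u = sheet r0" by (auto simp: v_def)
    have "homeomorphism u (base_star p0) proj (sect r0)"
    proof (rule homeomorphismI)
      show "continuous_on u proj"
        by (rule continuous_on_subset[OF cont]) (auto simp: r0(3) sheet_def)
      have "continuous_on ?X (sect r0)"
        unfolding sect_def by (rule continuous_on_push_point[OF finite_family_pcell])
      then show "continuous_on (base_star p0) (sect r0)"
        by (rule continuous_on_subset) (auto simp: base_star_def)
      show "proj ` u \<subseteq> base_star p0" using proj_sheet[OF _ r0(1)] r0 by auto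
      show "sect r0 ` base_star p0 \<subseteq> u" using sect_in_sheet(1)[OF r0(1)] r0 by auto
      show "sect r0 (proj r) = r" if "r \<in> u" for r using sect_proj[OF r0(1)] r0(3) that by simp
      show "proj (sect r0 p) = p" if "p \<in> base_star p0" for p
        using sect_in_sheet(2)[OF r0(1)] r0(2) that by simp
    qed
    then show "\<exists>q. homeomorphism u (base_star p0) proj q" by blast
  qed
qed

end

section \<open>Injectivity on fundamental groups\<close>

context link_inclusion
begin

sublocale cover: completion n "link_graph \<Gamma>A' \<Gamma>B'" "compatible (simplices \<Gamma>A') (simplices \<Gamma>B')" V
  by unfold_locales

lemma homotopic_paths_F:
  assumes \<gamma>1: "path \<gamma>1" "path_image \<gamma>1 \<subseteq> X" and \<gamma>2: "path \<gamma>2" "path_image \<gamma>2 \<subseteq> X"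
    and start: "pathstart \<gamma>1 = pathstart \<gamma>2" and hom: "homotopic_paths X' (F \<circ> \<gamma>1) (F \<circ> \<gamma>2)"
  shows "homotopic_paths X \<gamma>1 \<gamma>2"
proof -
  let ?C = "points n cover.cover_cell"
  \<comment> \<open>The map \<open>?D\<close> is the diagonal embedding of the source, and
    \<open>?H\<close> keeps only the second coordinate, which stays in \<open>V\<close>. Thus
    \<open>?H\<close> is a left inverse of \<open>?D\<close>, and \<open>?D\<close> gives explicit
    lifts of both image paths with a common starting point.\<close>
  let ?D = "push_point n (\<lambda>_ u. (f u, f u))" and ?H = "push_point n (\<lambda>_. f_inv \<circ> snd)"
  have fV: "f ` support (x i) \<subseteq> V" if "x \<in> X" "i \<in> {1..n}" for x i
    using support_in_W[OF that] f_in_V by blast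
  have D: "?D x \<in> ?C" if x: "x \<in> X" for x
  proof (rule push_point_in_points[OF x cover.local_family_cover_cell])
    have "cover.cover_cell (\<lambda>i. (\<lambda>u. (u, u)) ` f ` support (x i))"
      by (rule cover.cover_cell_diagonal[OF link_cell_f[OF supports_points[OF x]] fV[OF x]])
    then show "cover.cover_cell (\<lambda>i. (\<lambda>u. (f u, f u)) ` support (x i))" by (simp add: image_image)
  qed
  have H: "?H r \<in> X" if r: "r \<in> ?C" for r
  proof (rule push_point_in_points[OF r source.local_family_pcell])
    note S = supports_points[OF r]
    have "link_cell n \<Gamma>A \<Gamma>B (\<lambda>i. f_inv ` snd ` support (r i))"
      using link_cell_f_inv[OF cover.cover_cellD(2)[OF S]] S by (simp add: cover.cover_cell_def)
    then show "link_cell n \<Gamma>A \<Gamma>B (\<lambda>i. (f_inv \<circ> snd) ` support (r i))" by (simp add: image_comp)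
  qed
  have HD: "?H (?D x) = x" if x: "x \<in> X" for x
    unfolding push_point_push_point[OF x]
    by (rule push_point_ident[OF x]) (simp add: f_inv_f support_in_W[OF x])
  have FD: "cover.proj (?D x) = F x" if x: "x \<in> X" for x
    unfolding push_point_push_point[OF x] by (simp add: comp_def)
  have contD: "continuous_on X ?D" by (rule continuous_on_push_point[OF source.finite_family_pcell])
  have contH: "continuous_on ?C ?H" by (rule continuous_on_push_point[OF cover.finite_family_cover_cell])
  have in_X: "\<gamma>1 t \<in> X" "\<gamma>2 t \<in> X" if "t \<in> {0..1}" for t
    using \<gamma>1(2) \<gamma>2(2) that by (auto simp: path_image_def)
  \<comment> \<open>The starting point shows that the source is nonempty, as surjectivity of the
    covering requires.\<close>
  have "pathstart \<gamma>1 \<in> X" using \<gamma>1(2) by auto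
  then have q: "F (pathstart \<gamma>1) \<in> X'" "\<And>i. i \<in> {1..n} \<Longrightarrow> support (F (pathstart \<gamma>1) i) \<subseteq> V"
    using F_in_X' fV support_push_point[of _ n "pathstart \<gamma>1" "\<lambda>_. f"] weight_points[of "pathstart \<gamma>1" n]
    by simp_all
  obtain E :: "(nat \<Rightarrow>\<^sub>C real) set" and e e' where e: "homeomorphism ?C E e e'"
    using points_embedding[OF cover.finite_family_cover_cell] by blast
  obtain K :: "(nat \<Rightarrow>\<^sub>C real) set" and k k' where k: "homeomorphism X' K k k'"
    using points_embedding[OF target.finite_family_pcell] by blast
  have "homotopic_paths ?C (?D \<circ> \<gamma>1) (?D \<circ> \<gamma>2)"
  proof (rule covering_space_lift_homotopic_paths_embedded[OF cover.covering_space_proj[OF q] e k hom])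
    show "path (?D \<circ> \<gamma>1)" "path (?D \<circ> \<gamma>2)"
      using \<gamma>1 \<gamma>2 contD by (auto intro!: path_continuous_image elim: continuous_on_subset)
    show "path_image (?D \<circ> \<gamma>1) \<subseteq> ?C" "path_image (?D \<circ> \<gamma>2) \<subseteq> ?C"
      using \<gamma>1(2) \<gamma>2(2) D by (auto simp: path_image_compose)
    show "pathstart (?D \<circ> \<gamma>1) = pathstart (?D \<circ> \<gamma>2)" using start by (simp add: pathstart_compose)
  qed (simp_all add: FD in_X)
  then have 1: "homotopic_paths X (?H \<circ> (?D \<circ> \<gamma>1)) (?H \<circ> (?D \<circ> \<gamma>2))"
    using homotopic_paths_continuous_image[OF _ contH] H by blast
  have 2: "homotopic_paths X \<gamma>1 (?H \<circ> (?D \<circ> \<gamma>1))" "homotopic_paths X \<gamma>2 (?H \<circ> (?D \<circ> \<gamma>2))"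
    using \<gamma>1 \<gamma>2 in_X by (auto intro!: homotopic_paths_eq simp: HD)
  show ?thesis
    by (rule homotopic_paths_trans[OF 2(1) homotopic_paths_trans[OF 1 homotopic_paths_sym[OF 2(2)]]])
qed

lemma induced_map_F_mon:
  "induced_map X' F \<in> mon (fundamental_group X x0) (fundamental_group X' (F x0))"
proof (rule induced_map_mon)
  show "continuous_on X F" by (rule continuous_on_push_point[OF source.finite_family_pcell])
  show "F \<in> X \<rightarrow> X'" using F_in_X' by blast
  show "homotopic_paths X p q"
    if "p \<in> loops_at X x0" "q \<in> loops_at X x0" "homotopic_paths X' (F \<circ> p) (F \<circ> q)" for p q
    using that by (intro homotopic_paths_F) (auto simp: loops_at_def)
qed

end

theorem theoremB:
  fixes n :: nat
    and \<Gamma>A :: "'a coloured_complex" and \<Gamma>A' :: "'c coloured_complex"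
    and \<Gamma>B :: "'b coloured_complex" and \<Gamma>B' :: "'d coloured_complex"
    and fA :: "'a \<Rightarrow> 'c" and fB :: "'b \<Rightarrow> 'd"
  defines "X \<equiv> coupled_link_complex n \<Gamma>A \<Gamma>B"
    and "X' \<equiv> coupled_link_complex n \<Gamma>A' \<Gamma>B'"
    and "F \<equiv> coupled_map n fA fB"
  assumes "is_coloured n \<Gamma>A" and "flag_complex (simplices \<Gamma>A)"
    and "is_coloured n \<Gamma>A'" and "flag_complex (simplices \<Gamma>A')"
    and "is_coloured n \<Gamma>B" and "flag_complex (simplices \<Gamma>B)"
    and "is_coloured n \<Gamma>B'" and "flag_complex (simplices \<Gamma>B')"
    and "coloured_map \<Gamma>A \<Gamma>A' fA" and "coloured_map \<Gamma>B \<Gamma>B' fB"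
  shows "cubical_map n X X' F
    \<and> (\<forall>x\<in>link_vertices n \<Gamma>A \<Gamma>B. \<exists>y\<in>link_vertices n \<Gamma>A' \<Gamma>B'.
          A_part n y = fA ` A_part n x \<and> B_part n y = fB ` B_part n x
          \<and> F (vertex_point n x) = vertex_point n y)
    \<and> (full_inclusion (simplices \<Gamma>A) (simplices \<Gamma>A') fA
        \<and> full_inclusion (simplices \<Gamma>B) (simplices \<Gamma>B') fB \<longrightarrow>
          local_isometry n X X' F
          \<and> (\<forall>x0\<in>realization n X.
               induced_map (realization n X') F
                 \<in> mon (fundamental_group (realization n X) x0)
                        (fundamental_group (realization n X') (F x0))))"
proof (intro conjI impI ballI)
  note A = assms(4,5) and A' = assms(6,7) and B = assms(8,9) and B' = assms(10,11) and f = assms(12,13)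
  show "cubical_map n X X' F"
    unfolding X_def X'_def F_def by (rule cubical_map_coupled_map[OF A A' B B' f])
  show "\<exists>y\<in>link_vertices n \<Gamma>A' \<Gamma>B'. A_part n y = fA ` A_part n x \<and> B_part n y = fB ` B_part n x
      \<and> F (vertex_point n x) = vertex_point n y" if "x \<in> link_vertices n \<Gamma>A \<Gamma>B" for x
    unfolding F_def by (rule link_vertices_coupled_map[OF f that])
  assume full: "full_inclusion (simplices \<Gamma>A) (simplices \<Gamma>A') fA
    \<and> full_inclusion (simplices \<Gamma>B) (simplices \<Gamma>B') fB"
  interpret link_inclusion n \<Gamma>A \<Gamma>A' \<Gamma>B \<Gamma>B' fA fB
    by (rule link_inclusion.intro) (use A A' B B' f full in blast)+
  show "local_isometry n X X' F"
    unfolding X_def X'_def F_def coupled_map_eq by (rule local_isometry_F)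
  show "induced_map (realization n X') F
      \<in> mon (fundamental_group (realization n X) x0) (fundamental_group (realization n X') (F x0))" for x0
    unfolding X_def X'_def F_def coupled_map_eq realizations by (rule induced_map_F_mon)
qed

end
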